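(* Let $\mathbf{k}$ be a commutative unitary ring, $\lambda\in\mathbf{k}$, and let $X$ be a set. Let $(\mathrm{Sh}^{NC}(X),\overline{\diamond},P_X,j_X)$ be the Rota--Baxter algebra of angularly decorated planar rooted forests with decoration set $X$ (see context). The subalgebra $\mathrm{Sh}^{NC,0}(X)$ of $\mathrm{Sh}^{NC}(X)$ generated by the $\mathbf{k}$-basis $X^{\mathcal{F}^0}:=\bigcup_{F\in\mathcal{F}^0}X^F$ (i.e. the $\mathbf{k}$-submodule with basis $X^{\mathcal F^0}$), with the same product $\overline{\diamond}$, Rota--Baxter operator $P_X$ and set map $j_X$, is the free nonunitary Rota--Baxter algebra of weight $\lambda$ on $X$; that is, it is a nonunitary Rota--Baxter algebra of weight $\lambda$, and for any nonunitary Rota--Baxter algebra $(R,P)$ of weight $\lambda$ and any map $f:X\to R$ there is a unique nonunitary Rota--Baxter algebra morphism $\bar f:\mathrm{Sh}^{NC,0}(X)\to R$ with $\bar f\circ j_X=f$.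
   Context: Nonunitary Rota--Baxter algebra of weight $\lambda$: an associative $\mathbf{k}$-algebra $R$, not required to have an identity, with a $\mathbf{k}$-linear map $P:R\to R$ such that $P(x)P(y)=P\big(P(x)y+xP(y)+\lambda xy\big)$ for all $x,y\in R$. A morphism of nonunitary Rota--Baxter algebras is a $\mathbf{k}$-linear multiplicative map commuting with the operators. Forests: $\mathcal{T}$ is the set of planar rooted trees; $\bullet$ is the tree with a single vertex. $\mathcal{F}$ is the free semigroup generated by $\mathcal{T}$, with product (concatenation) denoted $\sqcup$; its elements $T_1\sqcup\cdots\sqcup T_b$ ($b\ge 1$, $T_i\in\mathcal{T}$) are called planar rooted forests. The grafting $\lfloor T_1\sqcup\cdots\sqcup T_b\rfloor$ is the tree obtained by adding a new root together with an edge from the new root to the root of each $T_i$ (keeping the order). Every tree is either $\bullet$ or of the form $\lfloor \overline{F}\rfloor$ for a unique forest $\overline{F}$. The depth of a tree is the length of the longest path from its root to a leaf; the depth $\mathrm{d}(F)$ of a forest is the maximal depth of its trees. $\ell(F)$ denotes the number of leaves of $F$ (with $\ell(\bullet)=1$). The product $\sqcup$ and the grafting $\lfloor\ \rfloor$ are extended (bi)linearly to $\mathbf{k}\,\mathcal{F}$, the free $\mathbf{k}$-module on $\mathcal F$. Ladder-free forests: $\mathcal{F}^0$ is the set of forests $F\in\mathcal{F}$ with $F\ne\bullet$ such that $F$ does not contain the subtree $\lfloor\bullet\rfloor$, i.e. none of the brackets $\lfloor B\rfloor$ occurring in $F$ is $\lfloor\bullet\rfloor$ (equivalently, no vertex of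 $F$ has exactly one child with that child a leaf). Product $\diamond$ on $\mathbf{k}\,\mathcal{F}$: defined on $\mathcal{F}\times\mathcal{F}$ by induction on $\mathrm{d}(F)+\mathrm{d}(F')$ and extended bilinearly. For trees $F,F'$: $F\diamond\bullet=F$, $\bullet\diamond F'=F'$, and if $F=\lfloor\overline{F}\rfloor$, $F'=\lfloor\overline{F}'\rfloor$ then $$F\diamond F'=\lfloor\lfloor\overline{F}\rfloor\diamond\overline{F}'\rfloor+\lfloor\overline{F}\diamond\lfloor\overline{F}'\rfloor\rfloor+\lambda\lfloor\overline{F}\diamond\overline{F}'\rfloor .$$ For forests $F=T_1\sqcup\cdots\sqcup T_b$ and $F'=T'_1\sqcup\cdots\sqcup T'_{b'}$, $F\diamond F'=T_1\sqcup\cdots\sqcup T_{b-1}\sqcup(T_b\diamond T'_1)\sqcup T'_2\sqcup\cdots\sqcup T'_{b'}$. The element $F\diamond F'$ is a linear combination of forests each having $\ell(F)+\ell(F')-1$ leaves; $\mathbf{k}\,\mathcal{F}^0$ is closed under $\diamond$ and under grafting. Decorated forests: for $F\in\mathcal{F}$, $X^F=\{(F;\vec x)\mid\vec x\in X^{\ell(F)-1}\}$, with $X^0=\{\mathbf 1\}$ (the empty tuple). $X^{\mathcal F}=\coprod_{F\in\mathcal{F}}X^F$ and $\mathrm{Sh}^{NC}(X)$ is the free $\mathbf{k}$-module on $X^{\mathcal F}$. If $\sum_ic_iF_i\in\mathbf{k}\,\mathcal{F}$ with all $F_i$ having $\ell$ leaves and $\vec x\in X^{\ell-1}$, then $(\sum_i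 c_iF_i;\vec x):=\sum_i c_i(F_i;\vec x)$. The product is $(F;\vec x)\,\overline{\diamond}\,(F';\vec x')=(F\diamond F';(\vec x,\vec x'))$ (concatenation of tuples), extended bilinearly; $P_X(F;\vec x)=(\lfloor F\rfloor;\vec x)$, extended linearly; $j_X(x)=(\bullet\sqcup\bullet;(x))$. *)

theory Defs
  imports "HOL-Algebra.Module" "HOL-Library.FuncSet"
begin

section \<open>Nonunitary Rota--Baxter algebras\<close>

text \<open>The field \<open>one\<close> of the record \<open>A\<close> is never referred to: the algebra need not be unital.\<close>

locale nonunitary_algebra = module k A
  for k (structure) and A (structure) +
  assumes mult_closed: "\<lbrakk>x \<in> carrier A; y \<in> carrier A\<rbrakk> \<Longrightarrow> x \<otimes>\<^bsub>A\<^esub> y \<in> carrier A"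
    and mult_assoc: "\<lbrakk>x \<in> carrier A; y \<in> carrier A; z \<in> carrier A\<rbrakk>
      \<Longrightarrow> (x \<otimes>\<^bsub>A\<^esub> y) \<otimes>\<^bsub>A\<^esub> z = x \<otimes>\<^bsub>A\<^esub> (y \<otimes>\<^bsub>A\<^esub> z)"
    and mult_l_distr: "\<lbrakk>x \<in> carrier A; y \<in> carrier A; z \<in> carrier A\<rbrakk>
      \<Longrightarrow> (x \<oplus>\<^bsub>A\<^esub> y) \<otimes>\<^bsub>A\<^esub> z = x \<otimes>\<^bsub>A\<^esub> z \<oplus>\<^bsub>A\<^esub> y \<otimes>\<^bsub>A\<^esub> z"
    and mult_r_distr: "\<lbrakk>x \<in> carrier A; y \<in> carrier A; z \<in> carrier A\<rbrakk>
      \<Longrightarrow> z \<otimes>\<^bsub>A\<^esub> (x \<oplus>\<^bsub>A\<^esub> y) = z \<otimes>\<^bsub>A\<^esub> x \<oplus>\<^bsub>A\<^esub> z \<otimes>\<^bsub>A\<^esub> y"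
    and mult_smult_l: "\<lbrakk>a \<in> carrier k; x \<in> carrier A; y \<in> carrier A\<rbrakk>
      \<Longrightarrow> (a \<odot>\<^bsub>A\<^esub> x) \<otimes>\<^bsub>A\<^esub> y = a \<odot>\<^bsub>A\<^esub> (x \<otimes>\<^bsub>A\<^esub> y)"
    and mult_smult_r: "\<lbrakk>a \<in> carrier k; x \<in> carrier A; y \<in> carrier A\<rbrakk>
      \<Longrightarrow> x \<otimes>\<^bsub>A\<^esub> (a \<odot>\<^bsub>A\<^esub> y) = a \<odot>\<^bsub>A\<^esub> (x \<otimes>\<^bsub>A\<^esub> y)"

locale nonunitary_rota_baxter_algebra = nonunitary_algebra k A
  for k (structure) and lam and A (structure) and P +
  assumes weight_closed: "lam \<in> carrier k"
    and op_closed: "x \<in> carrier A \<Longrightarrow> P x \<in> carrier A"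
    and op_add: "\<lbrakk>x \<in> carrier A; y \<in> carrier A\<rbrakk> \<Longrightarrow> P (x \<oplus>\<^bsub>A\<^esub> y) = P x \<oplus>\<^bsub>A\<^esub> P y"
    and op_smult: "\<lbrakk>a \<in> carrier k; x \<in> carrier A\<rbrakk> \<Longrightarrow> P (a \<odot>\<^bsub>A\<^esub> x) = a \<odot>\<^bsub>A\<^esub> P x"
    and rota_baxter: "\<lbrakk>x \<in> carrier A; y \<in> carrier A\<rbrakk>
      \<Longrightarrow> P x \<otimes>\<^bsub>A\<^esub> P y
        = P (P x \<otimes>\<^bsub>A\<^esub> y \<oplus>\<^bsub>A\<^esub> x \<otimes>\<^bsub>A\<^esub> P y \<oplus>\<^bsub>A\<^esub> lam \<odot>\<^bsub>A\<^esub> (x \<otimes>\<^bsub>A\<^esub> y))"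

definition rota_baxter_hom ::
  "('k, 'm) ring_scheme \<Rightarrow> ('k, 'a, 'n) module_scheme \<Rightarrow> ('a \<Rightarrow> 'a)
    \<Rightarrow> ('k, 'b, 'l) module_scheme \<Rightarrow> ('b \<Rightarrow> 'b) \<Rightarrow> ('a \<Rightarrow> 'b) set"
where
  "rota_baxter_hom k A P B Q =
    {h. h \<in> carrier A \<rightarrow> carrier B
      \<and> (\<forall>x\<in>carrier A. \<forall>y\<in>carrier A. h (x \<oplus>\<^bsub>A\<^esub> y) = h x \<oplus>\<^bsub>B\<^esub> h y)
      \<and> (\<forall>a\<in>carrier k. \<forall>x\<in>carrier A. h (a \<odot>\<^bsub>A\<^esub> x) = a \<odot>\<^bsub>B\<^esub> h x)
      \<and> (\<forall>x\<in>carrier A. \<forall>y\<in>carrier A. h (x \<otimes>\<^bsub>A\<^esub> y) = h x \<otimes>\<^bsub>B\<^esub> h y)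
      \<and> (\<forall>x\<in>carrier A. h (P x) = Q (h x))}"


section \<open>Free modules\<close>

definition supp :: "('k, 'm) ring_scheme \<Rightarrow> ('s \<Rightarrow> 'k) \<Rightarrow> 's set" where
  "supp k u = {s. u s \<noteq> \<zero>\<^bsub>k\<^esub>}"

text \<open>The free module on \<open>S\<close>: finitely supported \<open>k\<close>-valued functions vanishing off \<open>S\<close>.
  The fields \<open>mult\<close> and \<open>one\<close> carry no meaning.\<close>

definition free_module :: "('k, 'm) ring_scheme \<Rightarrow> 's set \<Rightarrow> ('k, 's \<Rightarrow> 'k) module" where
  "free_module k S =
    \<lparr> carrier = {u. range u \<subseteq> carrier k \<and> supp k u \<subseteq> S \<and> finite (supp k u)},
      mult = undefined, one = undefined,
      zero = (\<lambda>_. \<zero>\<^bsub>k\<^esub>), add = (\<lambda>u v s. u s \<oplus>\<^bsub>k\<^esub> v s),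
      smult = (\<lambda>c u s. c \<otimes>\<^bsub>k\<^esub> u s) \<rparr>"

definition basis_elem :: "('k, 'm) ring_scheme \<Rightarrow> 's \<Rightarrow> ('s \<Rightarrow> 'k)" where
  "basis_elem k s = (\<lambda>t. if t = s then \<one>\<^bsub>k\<^esub> else \<zero>\<^bsub>k\<^esub>)"

text \<open>The linear extension to a free module of a map \<open>g\<close> from its basis to the module \<open>M\<close>.\<close>

definition lin_ext ::
  "('k, 'm) ring_scheme \<Rightarrow> ('k, 'a, 'n) module_scheme \<Rightarrow> ('s \<Rightarrow> 'a) \<Rightarrow> ('s \<Rightarrow> 'k) \<Rightarrow> 'a"
where
  "lin_ext k M g u = (\<Oplus>\<^bsub>M\<^esub>s\<in>supp k u. u s \<odot>\<^bsub>M\<^esub> g s)"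


section \<open>Planar rooted trees and forests\<close>

text \<open>A tree is the list of the subtrees hanging at its root, so grafting a nonempty forest
  \<open>F\<close> gives \<open>Node F\<close>. A forest is a nonempty list of trees; concatenation is \<open>@\<close>.\<close>

datatype ptree = Node "ptree list"

abbreviation bullet :: ptree where "bullet \<equiv> Node []"

definition forests :: "ptree list set" where
  "forests = {F. F \<noteq> []}"

fun tree_leaves :: "ptree \<Rightarrow> nat" where
  "tree_leaves (Node F) = (if F = [] then 1 else sum_list (map tree_leaves F))"

definition leaves :: "ptree list \<Rightarrow> nat" where
  "leaves F = sum_list (map tree_leaves F)"

fun ladder_free :: "ptree \<Rightarrow> bool" where
  "ladder_free (Node F) \<longleftrightarrow> F \<noteq> [bullet] \<and> (\<forall>T\<in>set F. ladder_free T)"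

definition ladder_free_forests :: "ptree list set" where
  "ladder_free_forests = {F \<in> forests. F \<noteq> [bullet] \<and> (\<forall>T\<in>set F. ladder_free T)}"

abbreviation forest_module :: "('k, 'm) ring_scheme \<Rightarrow> ('k, ptree list \<Rightarrow> 'k) module" where
  "forest_module k \<equiv> free_module k forests"

definition graft :: "('k, 'm) ring_scheme \<Rightarrow> (ptree list \<Rightarrow> 'k) \<Rightarrow> (ptree list \<Rightarrow> 'k)" where
  "graft k = lin_ext k (forest_module k) (\<lambda>F. basis_elem k [Node F])"

lemma size_less_size_list: "T \<in> set F \<Longrightarrow> size T < size_list size F"
  by (induction F) auto

text \<open>The products of two trees and of two forests, with values in the free module on forests.
  The value \<open>\<zero>\<close> for an empty list of trees is a dummy.\<close>

function tree_prod ::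
    "('k, 'm) ring_scheme \<Rightarrow> 'k \<Rightarrow> ptree \<Rightarrow> ptree \<Rightarrow> (ptree list \<Rightarrow> 'k)"
  and forest_prod ::
    "('k, 'm) ring_scheme \<Rightarrow> 'k \<Rightarrow> ptree list \<Rightarrow> ptree list \<Rightarrow> (ptree list \<Rightarrow> 'k)"
where
  "tree_prod k lam (Node F) (Node G) =
    (if G = [] then basis_elem k [Node F]
     else if F = [] then basis_elem k [Node G]
     else graft k (forest_prod k lam [Node F] G)
       \<oplus>\<^bsub>forest_module k\<^esub> graft k (forest_prod k lam F [Node G])
       \<oplus>\<^bsub>forest_module k\<^esub> lam \<odot>\<^bsub>forest_module k\<^esub> graft k (forest_prod k lam F G))"
| "forest_prod k lam F G =
    (if F = [] \<or> G = [] then \<zero>\<^bsub>forest_module k\<^esub>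
     else lin_ext k (forest_module k) (\<lambda>H. basis_elem k (butlast F @ H @ tl G))
       (tree_prod k lam (last F) (hd G)))"
  by pat_completeness auto
termination
proof (relation "measure (\<lambda>x. case x of
    Inl (k, lam, T, U) \<Rightarrow> 2 * (size T + size U) + 1
  | Inr (k, lam, F, G) \<Rightarrow> 2 * (size_list size F + size_list size G))", goal_cases)
  case (5 k lam F G)
  then have "size (last F) < size_list size F" "size (hd G) < size_list size G"
    by (simp_all add: size_less_size_list)
  then show ?case by simp
qed auto


section \<open>Angularly decorated forests\<close>

text \<open>The union over \<open>F\<close> in \<open>S\<close> of the sets of pairs \<open>(F; x)\<close>, where \<open>x\<close> is a tuple of
  \<open>leaves F - 1\<close> elements of \<open>X\<close>.\<close>

definition decorated :: "'x set \<Rightarrow> ptree list set \<Rightarrow> (ptree list \<times> 'x list) set" where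
  "decorated X S = {(F, xs). F \<in> S \<and> set xs \<subseteq> X \<and> length xs = leaves F - 1}"

abbreviation dec_module ::
  "('k, 'm) ring_scheme \<Rightarrow> 'x set \<Rightarrow> ('k, ptree list \<times> 'x list \<Rightarrow> 'k) module"
where
  "dec_module k X \<equiv> free_module k (decorated X forests)"

definition decorate ::
  "('k, 'm) ring_scheme \<Rightarrow> 'x set \<Rightarrow> (ptree list \<Rightarrow> 'k) \<Rightarrow> 'x list
    \<Rightarrow> (ptree list \<times> 'x list \<Rightarrow> 'k)"
where
  "decorate k X u xs = lin_ext k (dec_module k X) (\<lambda>F. basis_elem k (F, xs)) u"

definition dec_prod ::
  "('k, 'm) ring_scheme \<Rightarrow> 'k \<Rightarrow> 'x set \<Rightarrow> (ptree list \<times> 'x list \<Rightarrow> 'k)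
    \<Rightarrow> (ptree list \<times> 'x list \<Rightarrow> 'k) \<Rightarrow> (ptree list \<times> 'x list \<Rightarrow> 'k)"
where
  "dec_prod k lam X u v =
    lin_ext k (dec_module k X) (\<lambda>(F, xs).
      lin_ext k (dec_module k X) (\<lambda>(G, ys).
        decorate k X (forest_prod k lam F G) (xs @ ys)) v) u"

definition ShNC ::
  "('k, 'm) ring_scheme \<Rightarrow> 'k \<Rightarrow> 'x set \<Rightarrow> ('k, ptree list \<times> 'x list \<Rightarrow> 'k) module"
where
  "ShNC k lam X = (dec_module k X)\<lparr> mult := dec_prod k lam X \<rparr>"

definition dec_op ::
  "('k, 'm) ring_scheme \<Rightarrow> 'x set \<Rightarrow> (ptree list \<times> 'x list \<Rightarrow> 'k)
    \<Rightarrow> (ptree list \<times> 'x list \<Rightarrow> 'k)"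
where
  "dec_op k X = lin_ext k (dec_module k X) (\<lambda>(F, xs). basis_elem k ([Node F], xs))"

definition dec_gen :: "('k, 'm) ring_scheme \<Rightarrow> 'x \<Rightarrow> (ptree list \<times> 'x list \<Rightarrow> 'k)" where
  "dec_gen k x = basis_elem k ([bullet, bullet], [x])"

definition ShNC0 ::
  "('k, 'm) ring_scheme \<Rightarrow> 'k \<Rightarrow> 'x set \<Rightarrow> ('k, ptree list \<times> 'x list \<Rightarrow> 'k) module"
where
  "ShNC0 k lam X = (ShNC k lam X)
    \<lparr> carrier := carrier (free_module k (decorated X ladder_free_forests)) \<rparr>"

end

theory Submission
  imports Defs
begin

text \<open>All the products and operators here are linear extensions of maps on bases, so every identity
  between them is checked on basis elements, that is, on forests.

  \<^bold>\<open>Algebra structure.\<close> The Rota--Baxter identity for \<open>\<diamond>\<close> and grafting is the recursive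
  definition of \<open>\<diamond>\<close> on trees other than \<open>\<bullet>\<close>. Associativity is an induction on the total
  size of three forests. The product \<open>F \<diamond> G\<close> only touches the last tree of \<open>F\<close> and the first tree
  of \<open>G\<close>, so it commutes with concatenation on the outer sides (\<open>diamond_concat_right\<close>,
  \<open>concat_diamond_left\<close>), which reduces the claim to three trees. If one of them is \<open>\<bullet>\<close>, it is a
  unit; otherwise all three are grafts, and expanding both sides by the Rota--Baxter identity
  expresses the claim by seven associativity statements about smaller forests
  (\<open>rota_baxter_assoc_step\<close>). Decorations are just concatenated, because \<open>F \<diamond> G\<close> is a
  combination of forests with \<open>\<ell>(F) + \<ell>(G) - 1\<close> leaves, and ladder-free forests are closed under
  both operations.

  \<^bold>\<open>Existence.\<close> A decorated forest is read from left to right as a word in an algebra \<open>A\<close> with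
  operator \<open>P\<close>: a tree \<open>\<lfloor>H\<rfloor>\<close> contributes the letter \<open>P(\<dots>)\<close> with the value of \<open>H\<close> inside, the
  decoration between two consecutive trees contributes the letter \<open>f x\<close>, and the tree \<open>\<bullet>\<close>
  contributes nothing. The value of the forest is the product of this word. As \<open>A\<close> need not have
  an identity, the empty word has no value; this is where ladder-freeness enters, since a
  ladder-free forest and all the forests grafted inside it yield nonempty words
  (\<open>forest_factors_nonempty\<close>). Multiplicativity (\<open>context_eval_diamond\<close>) follows the recursion of
  \<open>\<diamond>\<close>. There the last tree of a forest can well be \<open>\<bullet>\<close>, with an empty word, and so the induction
  evaluates a forest between two fixed words.

  \<^bold>\<open>Uniqueness.\<close> The generators \<open>(\<bullet>\<squnion>\<bullet>; x)\<close> produce all decorated ladder-free forests by products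
  and grafting (\<open>ShNC0_generated\<close>): multiplying by a generator inserts one decorated angle, and
  the units \<open>\<bullet>\<close> in it merge with the adjacent trees.\<close>

section \<open>Linear and bilinear maps on free modules\<close>

definition linear_map ::
  "('k, 'm) ring_scheme \<Rightarrow> ('k, 'a, 'n) module_scheme \<Rightarrow> ('k, 'b, 'l) module_scheme \<Rightarrow> ('a \<Rightarrow> 'b) set"
where
  "linear_map k M N =
    {h. h \<in> carrier M \<rightarrow> carrier N
      \<and> (\<forall>x\<in>carrier M. \<forall>y\<in>carrier M. h (x \<oplus>\<^bsub>M\<^esub> y) = h x \<oplus>\<^bsub>N\<^esub> h y)
      \<and> (\<forall>a\<in>carrier k. \<forall>x\<in>carrier M. h (a \<odot>\<^bsub>M\<^esub> x) = a \<odot>\<^bsub>N\<^esub> h x)}"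

lemma linear_mapI:
  assumes "\<And>x. x \<in> carrier M \<Longrightarrow> h x \<in> carrier N"
    and "\<And>x y. \<lbrakk>x \<in> carrier M; y \<in> carrier M\<rbrakk> \<Longrightarrow> h (x \<oplus>\<^bsub>M\<^esub> y) = h x \<oplus>\<^bsub>N\<^esub> h y"
    and "\<And>a x. \<lbrakk>a \<in> carrier k; x \<in> carrier M\<rbrakk> \<Longrightarrow> h (a \<odot>\<^bsub>M\<^esub> x) = a \<odot>\<^bsub>N\<^esub> h x"
  shows "h \<in> linear_map k M N"
  using assms by (auto simp: linear_map_def)

lemma linear_map_closed: "h \<in> linear_map k M N \<Longrightarrow> x \<in> carrier M \<Longrightarrow> h x \<in> carrier N"
  and linear_map_add: "h \<in> linear_map k M N \<Longrightarrow> x \<in> carrier M \<Longrightarrow> y \<in> carrier M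
    \<Longrightarrow> h (x \<oplus>\<^bsub>M\<^esub> y) = h x \<oplus>\<^bsub>N\<^esub> h y"
  and linear_map_smult: "h \<in> linear_map k M N \<Longrightarrow> a \<in> carrier k \<Longrightarrow> x \<in> carrier M
    \<Longrightarrow> h (a \<odot>\<^bsub>M\<^esub> x) = a \<odot>\<^bsub>N\<^esub> h x"
  by (auto simp: linear_map_def)

lemma linear_map_comp:
  assumes "g \<in> linear_map k M N" and "h \<in> linear_map k L M"
  shows "(\<lambda>x. g (h x)) \<in> linear_map k L N"
  using assms by (auto simp: linear_map_def Pi_iff)

lemma linear_map_add_maps:
  assumes "module k N" and "g \<in> linear_map k M N" and "h \<in> linear_map k M N"
  shows "(\<lambda>x. g x \<oplus>\<^bsub>N\<^esub> h x) \<in> linear_map k M N"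
proof -
  interpret module k N by fact
  show ?thesis
    using assms(2,3)
    by (auto simp: linear_map_def Pi_iff smult_r_distr M.a_ac)
qed

lemma linear_map_smult_map:
  assumes "module k N" and "c \<in> carrier k" and "h \<in> linear_map k M N"
  shows "(\<lambda>x. c \<odot>\<^bsub>N\<^esub> h x) \<in> linear_map k M N"
proof -
  interpret module k N by fact
  show ?thesis
    using assms(2,3)
    by (auto simp: linear_map_def Pi_iff smult_r_distr smult_assoc1[symmetric] R.m_comm)
qed

lemma free_module_ops:
  "add (free_module k S) = (\<lambda>u v s. u s \<oplus>\<^bsub>k\<^esub> v s)"
  "zero (free_module k S) = (\<lambda>_. \<zero>\<^bsub>k\<^esub>)"
  "smult (free_module k S) = (\<lambda>c u s. c \<otimes>\<^bsub>k\<^esub> u s)"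
  by (simp_all add: free_module_def)

lemma free_module_mono: "S \<subseteq> T \<Longrightarrow> carrier (free_module k S) \<subseteq> carrier (free_module k T)"
  by (auto simp: free_module_def)

lemma free_module_value_outside: "u \<in> carrier (free_module k S) \<Longrightarrow> s \<notin> S \<Longrightarrow> u s = \<zero>\<^bsub>k\<^esub>"
  by (auto simp: free_module_def supp_def)

lemma free_module_value_closed: "u \<in> carrier (free_module k S) \<Longrightarrow> u s \<in> carrier k"
  by (auto simp: free_module_def)

lemma free_module_finite_supp: "u \<in> carrier (free_module k S) \<Longrightarrow> finite (supp k u)"
  by (auto simp: free_module_def)

lemma free_module_supp: "u \<in> carrier (free_module k S) \<Longrightarrow> supp k u \<subseteq> S"
  by (auto simp: free_module_def)

lemma free_moduleI:
  assumes "\<And>s. u s \<in> carrier k" and "\<And>s. s \<notin> A \<Longrightarrow> u s = \<zero>\<^bsub>k\<^esub>" and "finite A"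
    and "\<And>s. s \<notin> S \<Longrightarrow> u s = \<zero>\<^bsub>k\<^esub>"
  shows "u \<in> carrier (free_module k S)"
proof -
  have "supp k u \<subseteq> A" using assms(2) by (auto simp: supp_def)
  then have "finite (supp k u)" using assms(3) finite_subset by blast
  then show ?thesis using assms(1,4) by (auto simp: free_module_def supp_def)
qed

text \<open>The operations of all free modules on sets of one type are the same functions.\<close>

lemma linear_map_free_mono:
  assumes "h \<in> linear_map k M (free_module k S)" and "S \<subseteq> T"
  shows "h \<in> linear_map k M (free_module k T)"
  using assms free_module_mono[OF assms(2), of k] by (auto simp: linear_map_def free_module_ops)

context cring
begin

lemma basis_elem_closed [simp]: "s \<in> S \<Longrightarrow> basis_elem R s \<in> carrier (free_module R S)"
  by (rule free_moduleI[where A = "{s}"]) (auto simp: basis_elem_def)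

lemma free_add_closed:
  assumes u: "u \<in> carrier (free_module R S)" and v: "v \<in> carrier (free_module R S)"
  shows "(\<lambda>s. u s \<oplus> v s) \<in> carrier (free_module R S)"
proof (rule free_moduleI[where A = "supp R u \<union> supp R v"])
  show "finite (supp R u \<union> supp R v)"
    using u v by (simp add: free_module_finite_supp)
qed (use free_module_value_closed[OF u] free_module_value_closed[OF v]
    free_module_value_outside[OF u] free_module_value_outside[OF v] in \<open>auto simp: supp_def\<close>)

lemma free_smult_closed:
  assumes c: "c \<in> carrier R" and u: "u \<in> carrier (free_module R S)"
  shows "(\<lambda>s. c \<otimes> u s) \<in> carrier (free_module R S)"
proof (rule free_moduleI[where A = "supp R u"])
  show "finite (supp R u)"
    using u by (simp add: free_module_finite_supp)
qed (use free_module_value_closed[OF u] free_module_value_outside[OF u] c in \<open>auto simp: supp_def\<close>)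

lemma free_zero_closed: "(\<lambda>s. \<zero>) \<in> carrier (free_module R S)"
  by (rule free_moduleI[where A = "{}"]) auto

lemma free_module_module: "module R (free_module R S)"
proof (rule moduleI)
  show "cring R" by (rule cring_axioms)
  show "abelian_group (free_module R S)"
  proof (rule abelian_groupI)
    fix u assume u: "u \<in> carrier (free_module R S)"
    have "(\<lambda>s. \<ominus> \<one> \<otimes> u s) \<in> carrier (free_module R S)"
      by (rule free_smult_closed) (use u in auto)
    moreover have "(\<lambda>s. \<ominus> \<one> \<otimes> u s) \<oplus>\<^bsub>free_module R S\<^esub> u = \<zero>\<^bsub>free_module R S\<^esub>"
      using free_module_value_closed[OF u] by (simp add: free_module_ops l_minus l_neg)
    ultimately show "\<exists>v\<in>carrier (free_module R S). v \<oplus>\<^bsub>free_module R S\<^esub> u = \<zero>\<^bsub>free_module R S\<^esub>"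
      by blast
  qed (auto simp: free_module_ops free_add_closed free_zero_closed fun_eq_iff
      intro: a_assoc a_comm l_zero free_module_value_closed)
qed (auto simp: free_module_ops free_smult_closed fun_eq_iff
    intro: l_distr r_distr m_assoc l_one free_module_value_closed)

text \<open>A finitely supported function is built up from \<open>0\<close> by adding one basis element of its support
  at a time.\<close>

lemma free_module_induct [consumes 1, case_names zero step]:
  assumes "u \<in> carrier (free_module R S)"
    and zero: "Q (\<lambda>_. \<zero>)"
    and step: "\<And>c s u. \<lbrakk>c \<in> carrier R; s \<in> S; u \<in> carrier (free_module R S); Q u\<rbrakk>
      \<Longrightarrow> Q ((c \<odot>\<^bsub>free_module R S\<^esub> basis_elem R s) \<oplus>\<^bsub>free_module R S\<^esub> u)"
  shows "Q u"
proof -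
  have "Q u" if "finite A" "u \<in> carrier (free_module R S)" "supp R u \<subseteq> A" "A \<subseteq> S" for A u
    using that
  proof (induction A arbitrary: u rule: finite_induct)
    case empty
    then have "u = (\<lambda>_. \<zero>)" by (auto simp: supp_def)
    then show ?case using zero by simp
  next
    case (insert a A)
    let ?v = "u(a := \<zero>)"
    note u_closed = free_module_value_closed[OF insert.prems(1)]
    have "finite (supp R u)" using insert.prems(1) by (rule free_module_finite_supp)
    then have v: "?v \<in> carrier (free_module R S)"
    proof (rule free_moduleI[rotated 2])
      show "?v s = \<zero>" if "s \<notin> S" for s
        using free_module_value_outside[OF insert.prems(1) that] by simp
    qed (simp_all add: u_closed supp_def)
    have "Q ?v"
    proof (rule insert.IH[OF v])
      show "supp R ?v \<subseteq> A" using insert.prems(2) by (auto simp: supp_def)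
      show "A \<subseteq> S" using insert.prems(3) by simp
    qed
    then have "Q ((u a \<odot>\<^bsub>free_module R S\<^esub> basis_elem R a) \<oplus>\<^bsub>free_module R S\<^esub> ?v)"
      using insert.prems(3) by (intro step[OF u_closed _ v]) simp
    moreover have "(u a \<odot>\<^bsub>free_module R S\<^esub> basis_elem R a) \<oplus>\<^bsub>free_module R S\<^esub> ?v = u"
      by (rule ext) (simp add: free_module_ops basis_elem_def u_closed)
    ultimately show ?case by simp
  qed
  from this[OF free_module_finite_supp[OF assms(1)] assms(1) order_refl free_module_supp[OF assms(1)]]
  show ?thesis .
qed

lemma linear_map_zero:
  assumes "module R M" and "module R N" and "h \<in> linear_map R M N"
  shows "h \<zero>\<^bsub>M\<^esub> = \<zero>\<^bsub>N\<^esub>"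
proof -
  interpret M: module R M by fact
  interpret N: module R N by fact
  have "h (\<zero> \<odot>\<^bsub>M\<^esub> \<zero>\<^bsub>M\<^esub>) = \<zero> \<odot>\<^bsub>N\<^esub> h \<zero>\<^bsub>M\<^esub>"
    by (rule linear_map_smult[OF assms(3)]) auto
  then show ?thesis
    using linear_map_closed[OF assms(3), of "\<zero>\<^bsub>M\<^esub>"] by simp
qed

lemma linear_map_eqI:
  assumes "module R N"
    and g: "g \<in> linear_map R (free_module R S) N" and h: "h \<in> linear_map R (free_module R S) N"
    and basis: "\<And>s. s \<in> S \<Longrightarrow> g (basis_elem R s) = h (basis_elem R s)"
    and u: "u \<in> carrier (free_module R S)"
  shows "g u = h u"
  using u
proof (induction u rule: free_module_induct)
  case zero
  show ?case
    using linear_map_zero[OF free_module_module \<open>module R N\<close> g]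
      linear_map_zero[OF free_module_module \<open>module R N\<close> h] by (simp add: free_module_ops)
next
  case (step c s u)
  interpret F: module R "free_module R S" by (rule free_module_module)
  have cl: "c \<odot>\<^bsub>free_module R S\<^esub> basis_elem R s \<in> carrier (free_module R S)"
    by (rule F.smult_closed) (use step in auto)
  show ?case
    unfolding linear_map_add[OF g cl step(3)] linear_map_add[OF h cl step(3)]
    using step basis linear_map_smult[OF g step(1), of "basis_elem R s"]
      linear_map_smult[OF h step(1), of "basis_elem R s"] by simp
qed

text \<open>The sum defining a linear extension ranges over the support, which varies with the argument.
  Padding it by zero terms puts two arguments over a common index set, as additivity requires.\<close>

lemma lin_ext_finite_superset:
  assumes "module R N" and "g \<in> S \<rightarrow> carrier N" and u: "u \<in> carrier (free_module R S)"
    and "finite A" and "supp R u \<subseteq> A" and "A \<subseteq> S"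
  shows "lin_ext R N g u = (\<Oplus>\<^bsub>N\<^esub>s\<in>A. u s \<odot>\<^bsub>N\<^esub> g s)"
proof -
  interpret N: module R N by fact
  show ?thesis
    unfolding lin_ext_def
    by (rule N.add.finprod_mono_neutral_cong_left)
      (use assms free_module_value_closed[OF u] in \<open>auto simp: supp_def Pi_iff subset_eq\<close>)
qed

lemma lin_ext_linear:
  assumes "module R N" and g: "g \<in> S \<rightarrow> carrier N"
  shows "lin_ext R N g \<in> linear_map R (free_module R S) N"
proof -
  interpret N: module R N by fact
  note superset = lin_ext_finite_superset[OF assms]
  show ?thesis
  proof (rule linear_mapI)
    fix u assume u: "u \<in> carrier (free_module R S)"
    have "supp R u \<subseteq> S" by (rule free_module_supp[OF u])
    then show "lin_ext R N g u \<in> carrier N"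
      using g free_module_value_closed[OF u] unfolding lin_ext_def
      by (intro N.finsum_closed) (auto simp: Pi_iff)
  next
    fix u v assume u: "u \<in> carrier (free_module R S)" and v: "v \<in> carrier (free_module R S)"
    let ?A = "supp R u \<union> supp R v"
    have fin: "finite ?A" using u v by (simp add: free_module_finite_supp)
    have sub: "?A \<subseteq> S" using u v free_module_supp by blast
    have cl: "(\<lambda>s. u s \<odot>\<^bsub>N\<^esub> g s) \<in> ?A \<rightarrow> carrier N" "(\<lambda>s. v s \<odot>\<^bsub>N\<^esub> g s) \<in> ?A \<rightarrow> carrier N"
      using g sub free_module_value_closed[OF u] free_module_value_closed[OF v]
      by (auto simp: Pi_iff subset_eq)
    have "lin_ext R N g (\<lambda>s. u s \<oplus> v s) = (\<Oplus>\<^bsub>N\<^esub>s\<in>?A. (u s \<oplus> v s) \<odot>\<^bsub>N\<^esub> g s)"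
      by (rule superset) (use free_add_closed[OF u v] fin sub l_zero in \<open>auto simp: supp_def\<close>)
    also have "\<dots> = (\<Oplus>\<^bsub>N\<^esub>s\<in>?A. u s \<odot>\<^bsub>N\<^esub> g s \<oplus>\<^bsub>N\<^esub> v s \<odot>\<^bsub>N\<^esub> g s)"
      by (rule N.finsum_cong)
        (use g sub free_module_value_closed[OF u] free_module_value_closed[OF v] in
          \<open>auto simp: simp_implies_def Pi_iff subset_eq N.smult_l_distr\<close>)
    also have "\<dots> = (\<Oplus>\<^bsub>N\<^esub>s\<in>?A. u s \<odot>\<^bsub>N\<^esub> g s) \<oplus>\<^bsub>N\<^esub> (\<Oplus>\<^bsub>N\<^esub>s\<in>?A. v s \<odot>\<^bsub>N\<^esub> g s)"
      by (rule N.finsum_addf) (use cl in auto)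
    also have "(\<Oplus>\<^bsub>N\<^esub>s\<in>?A. u s \<odot>\<^bsub>N\<^esub> g s) = lin_ext R N g u"
      by (rule superset[symmetric]) (use u fin sub in auto)
    also have "(\<Oplus>\<^bsub>N\<^esub>s\<in>?A. v s \<odot>\<^bsub>N\<^esub> g s) = lin_ext R N g v"
      by (rule superset[symmetric]) (use v fin sub in auto)
    finally show "lin_ext R N g (u \<oplus>\<^bsub>free_module R S\<^esub> v) = lin_ext R N g u \<oplus>\<^bsub>N\<^esub> lin_ext R N g v"
      by (simp add: free_module_ops)
  next
    fix c u assume c: "c \<in> carrier R" and u: "u \<in> carrier (free_module R S)"
    let ?A = "supp R u"
    have fin: "finite ?A" using u by (simp add: free_module_finite_supp)
    have sub: "?A \<subseteq> S" using u free_module_supp by blast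
    have "lin_ext R N g (\<lambda>s. c \<otimes> u s) = (\<Oplus>\<^bsub>N\<^esub>s\<in>?A. (c \<otimes> u s) \<odot>\<^bsub>N\<^esub> g s)"
      by (rule superset) (use free_smult_closed[OF c u] fin sub c in \<open>auto simp: supp_def\<close>)
    also have "\<dots> = (\<Oplus>\<^bsub>N\<^esub>s\<in>?A. c \<odot>\<^bsub>N\<^esub> (u s \<odot>\<^bsub>N\<^esub> g s))"
      by (rule N.finsum_cong)
        (use g sub c free_module_value_closed[OF u] in
          \<open>auto simp: simp_implies_def Pi_iff subset_eq N.smult_assoc1\<close>)
    also have "\<dots> = c \<odot>\<^bsub>N\<^esub> lin_ext R N g u"
      unfolding lin_ext_def
      by (rule N.finsum_smult_ldistr[symmetric])
        (use g sub c fin free_module_value_closed[OF u] in \<open>auto simp: Pi_iff subset_eq\<close>)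
    finally show "lin_ext R N g (c \<odot>\<^bsub>free_module R S\<^esub> u) = c \<odot>\<^bsub>N\<^esub> lin_ext R N g u"
      by (simp add: free_module_ops)
  qed
qed

lemma lin_ext_basis:
  assumes "module R N" and "g s \<in> carrier N"
  shows "lin_ext R N g (basis_elem R s) = g s"
proof -
  interpret N: module R N by fact
  have "lin_ext R N g (basis_elem R s) = (\<Oplus>\<^bsub>N\<^esub>t\<in>{s}. basis_elem R s t \<odot>\<^bsub>N\<^esub> g t)"
    by (rule lin_ext_finite_superset[where S = "{s}"])
      (use assms basis_elem_closed[of s "{s}"] in \<open>auto simp: supp_def basis_elem_def\<close>)
  then show ?thesis using assms by (simp add: basis_elem_def)
qed

text \<open>This lets a construction that is defined in a large free module, such as that on all decorated
  forests, be computed in any free submodule that contains its values.\<close>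

lemma lin_ext_enlarge:
  assumes "g \<in> S \<rightarrow> carrier (free_module R T)" and "T \<subseteq> T'" and "u \<in> carrier (free_module R S)"
  shows "lin_ext R (free_module R T') g u = lin_ext R (free_module R T) g u"
proof (rule linear_map_eqI[OF free_module_module _ _ _ assms(3)])
  have g': "g \<in> S \<rightarrow> carrier (free_module R T')"
    using assms(1) free_module_mono[OF assms(2), of R] by auto
  show "lin_ext R (free_module R T') g \<in> linear_map R (free_module R S) (free_module R T')"
    by (rule lin_ext_linear[OF free_module_module g'])
  show "lin_ext R (free_module R T) g \<in> linear_map R (free_module R S) (free_module R T')"
    by (rule linear_map_free_mono[OF lin_ext_linear[OF free_module_module assms(1)] assms(2)])
  show "lin_ext R (free_module R T') g (basis_elem R s) = lin_ext R (free_module R T) g (basis_elem R s)"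
    if "s \<in> S" for s
    using assms(1) g' that by (simp add: lin_ext_basis free_module_module Pi_iff)
qed

end

text \<open>A linear extension is specified only on its free module, so linearity must be insensitive to the
  values of a map elsewhere.\<close>

lemma linear_map_cong:
  assumes "h \<in> linear_map k M N" and "\<And>x. x \<in> carrier M \<Longrightarrow> g x = h x"
    and "module k M"
  shows "g \<in> linear_map k M N"
proof -
  interpret module k M by fact
  show ?thesis using assms(1,2) by (auto simp: linear_map_def Pi_iff)
qed

lemma linear_map_id: "(\<lambda>x. x) \<in> linear_map k M M"
  by (simp add: linear_map_def)

definition bilinear_map ::
  "('k, 'm) ring_scheme \<Rightarrow> ('k, 'a, 'n) module_scheme \<Rightarrow> ('k, 'b, 'l) module_scheme
    \<Rightarrow> ('k, 'c, 'o) module_scheme \<Rightarrow> ('a \<Rightarrow> 'b \<Rightarrow> 'c) set"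
where
  "bilinear_map k M M' N =
    {b. (\<forall>x\<in>carrier M. b x \<in> linear_map k M' N)
      \<and> (\<forall>y\<in>carrier M'. (\<lambda>x. b x y) \<in> linear_map k M N)}"

lemma bilinear_mapI:
  assumes "\<And>x. x \<in> carrier M \<Longrightarrow> (\<lambda>y. b x y) \<in> linear_map k M' N"
    and "\<And>y. y \<in> carrier M' \<Longrightarrow> (\<lambda>x. b x y) \<in> linear_map k M N"
  shows "b \<in> bilinear_map k M M' N"
  using assms by (simp add: bilinear_map_def)

lemma bilinear_map_right: "b \<in> bilinear_map k M M' N \<Longrightarrow> x \<in> carrier M \<Longrightarrow> b x \<in> linear_map k M' N"
  and bilinear_map_left:
    "b \<in> bilinear_map k M M' N \<Longrightarrow> y \<in> carrier M' \<Longrightarrow> (\<lambda>x. b x y) \<in> linear_map k M N"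
  by (simp_all add: bilinear_map_def)

lemma bilinear_map_closed:
  "b \<in> bilinear_map k M M' N \<Longrightarrow> x \<in> carrier M \<Longrightarrow> y \<in> carrier M' \<Longrightarrow> b x y \<in> carrier N"
  by (rule linear_map_closed[OF bilinear_map_right])

lemma bilinear_map_comp:
  assumes "b \<in> bilinear_map k M M' N" and "g \<in> linear_map k L M" and "h \<in> linear_map k L' M'"
  shows "(\<lambda>x y. b (g x) (h y)) \<in> bilinear_map k L L' N"
proof (rule bilinear_mapI)
  show "(\<lambda>y. b (g x) (h y)) \<in> linear_map k L' N" if "x \<in> carrier L" for x
    by (rule linear_map_comp[OF bilinear_map_right[OF assms(1) linear_map_closed[OF assms(2) that]]
          assms(3)])
  show "(\<lambda>x. b (g x) (h y)) \<in> linear_map k L N" if "y \<in> carrier L'" for y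
    by (rule linear_map_comp[OF bilinear_map_left[OF assms(1) linear_map_closed[OF assms(3) that]]
          assms(2)])
qed

lemma linear_bilinear_map_comp:
  assumes "g \<in> linear_map k N L" and "b \<in> bilinear_map k M M' N"
  shows "(\<lambda>x y. g (b x y)) \<in> bilinear_map k M M' L"
  by (rule bilinear_mapI)
    (rule linear_map_comp[OF assms(1)], erule bilinear_map_right[OF assms(2)] bilinear_map_left[OF assms(2)])+

lemma bilinear_map_add_maps:
  assumes "module k N" and "b \<in> bilinear_map k M M' N" and "c \<in> bilinear_map k M M' N"
  shows "(\<lambda>x y. b x y \<oplus>\<^bsub>N\<^esub> c x y) \<in> bilinear_map k M M' N"
  using assms by (simp add: bilinear_map_def linear_map_add_maps)

lemma bilinear_map_smult_map:
  assumes "module k N" and "a \<in> carrier k" and "b \<in> bilinear_map k M M' N"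
  shows "(\<lambda>x y. a \<odot>\<^bsub>N\<^esub> b x y) \<in> bilinear_map k M M' N"
  using assms by (simp add: bilinear_map_def linear_map_smult_map)

lemma bilinear_map_cong:
  assumes c: "c \<in> bilinear_map k M M' N" and "module k M" and "module k M'"
    and eq: "\<And>x y. \<lbrakk>x \<in> carrier M; y \<in> carrier M'\<rbrakk> \<Longrightarrow> b x y = c x y"
  shows "b \<in> bilinear_map k M M' N"
proof (rule bilinear_mapI)
  show "(\<lambda>y. b x y) \<in> linear_map k M' N" if "x \<in> carrier M" for x
    by (rule linear_map_cong[OF bilinear_map_right[OF c that] eq[OF that] assms(3)])
  show "(\<lambda>x. b x y) \<in> linear_map k M N" if "y \<in> carrier M'" for y
    by (rule linear_map_cong[OF bilinear_map_left[OF c that] eq[OF _ that] assms(2)])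
qed

lemma bilinear_map_free_mono:
  assumes "b \<in> bilinear_map k M M' (free_module k S)" and "S \<subseteq> T"
  shows "b \<in> bilinear_map k M M' (free_module k T)"
  using assms(1) by (auto simp: bilinear_map_def intro: linear_map_free_mono[OF _ assms(2)])

definition bilin_ext ::
  "('k, 'm) ring_scheme \<Rightarrow> ('k, 'a, 'n) module_scheme \<Rightarrow> ('s \<Rightarrow> 't \<Rightarrow> 'a)
    \<Rightarrow> ('s \<Rightarrow> 'k) \<Rightarrow> ('t \<Rightarrow> 'k) \<Rightarrow> 'a"
where
  "bilin_ext k N m u v = lin_ext k N (\<lambda>s. lin_ext k N (m s) v) u"

context cring
begin

lemma lin_ext_linear_free:
  assumes "g \<in> S \<rightarrow> carrier (free_module R T)" and "T \<subseteq> T'"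
  shows "lin_ext R (free_module R T') g \<in> linear_map R (free_module R S) (free_module R T)"
  by (rule linear_map_cong[OF lin_ext_linear[OF free_module_module assms(1)] _ free_module_module])
    (rule lin_ext_enlarge[OF assms])

lemma lin_ext_basis_elem_self:
  assumes "u \<in> carrier (free_module R S)" and "S \<subseteq> T"
  shows "lin_ext R (free_module R T) (basis_elem R) u = u"
  by (rule linear_map_eqI[OF free_module_module lin_ext_linear[OF free_module_module] linear_map_id _ ])
    (use assms free_module_mono[OF assms(2), of R] in \<open>auto simp: lin_ext_basis free_module_module\<close>)

text \<open>Linearity in the first argument is that of a linear extension. For the second argument, the
  first one is a finite combination of basis elements, and linear maps are closed under
  combinations.\<close>

lemma bilin_ext_bilinear:
  assumes N: "module R N" and m: "\<And>s t. s \<in> S \<Longrightarrow> t \<in> T \<Longrightarrow> m s t \<in> carrier N"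
  shows "bilin_ext R N m \<in> bilinear_map R (free_module R S) (free_module R T) N"
proof (rule bilinear_mapI)
  interpret N: module R N by fact
  have row: "lin_ext R N (m s) \<in> linear_map R (free_module R T) N" if "s \<in> S" for s
    by (rule lin_ext_linear[OF N]) (use m that in auto)
  show left: "(\<lambda>u. bilin_ext R N m u v) \<in> linear_map R (free_module R S) N"
    if "v \<in> carrier (free_module R T)" for v
    unfolding bilin_ext_def
    by (rule lin_ext_linear[OF N]) (use linear_map_closed[OF row] that in auto)
  show "(\<lambda>v. bilin_ext R N m u v) \<in> linear_map R (free_module R T) N"
    if "u \<in> carrier (free_module R S)" for u
    using that
  proof (induction u rule: free_module_induct)
    case zero
    have "(\<lambda>v. \<zero>\<^bsub>N\<^esub>) \<in> linear_map R (free_module R T) N"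
      by (rule linear_mapI) auto
    moreover have "bilin_ext R N m (\<lambda>_. \<zero>) v = \<zero>\<^bsub>N\<^esub>" if "v \<in> carrier (free_module R T)" for v
      using linear_map_zero[OF free_module_module N left[OF that]] by (simp add: free_module_ops)
    ultimately show ?case
      using free_module_module by (rule linear_map_cong)
  next
    case (step c s u)
    interpret F: module R "free_module R S" by (rule free_module_module)
    have "bilin_ext R N m (c \<odot>\<^bsub>free_module R S\<^esub> basis_elem R s \<oplus>\<^bsub>free_module R S\<^esub> u) v
        = c \<odot>\<^bsub>N\<^esub> lin_ext R N (m s) v \<oplus>\<^bsub>N\<^esub> bilin_ext R N m u v"
      if v: "v \<in> carrier (free_module R T)" for v
      unfolding linear_map_add[OF left[OF v] F.smult_closed[OF step(1) basis_elem_closed[OF step(2)]] step(3)]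
        linear_map_smult[OF left[OF v] step(1) basis_elem_closed[OF step(2)]]
      using linear_map_closed[OF row[OF step(2)] v]
      by (simp add: bilin_ext_def lin_ext_basis[OF N])
    with linear_map_add_maps[OF N linear_map_smult_map[OF N step(1) row[OF step(2)]] step(4)]
    show ?case
      using free_module_module by (rule linear_map_cong)
  qed
qed

lemma bilin_ext_basis:
  assumes "module R N" and "m s t \<in> carrier N"
  shows "bilin_ext R N m (basis_elem R s) (basis_elem R t) = m s t"
  using assms by (simp add: bilin_ext_def lin_ext_basis)

lemma bilinear_map_eqI:
  assumes N: "module R N"
    and b: "b \<in> bilinear_map R (free_module R S) (free_module R T) N"
    and c: "c \<in> bilinear_map R (free_module R S) (free_module R T) N"
    and basis: "\<And>s t. \<lbrakk>s \<in> S; t \<in> T\<rbrakk>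
      \<Longrightarrow> b (basis_elem R s) (basis_elem R t) = c (basis_elem R s) (basis_elem R t)"
    and u: "u \<in> carrier (free_module R S)" and v: "v \<in> carrier (free_module R T)"
  shows "b u v = c u v"
proof (rule linear_map_eqI[OF N bilinear_map_right[OF b u] bilinear_map_right[OF c u] _ v])
  show "b u (basis_elem R t) = c u (basis_elem R t)" if t: "t \<in> T" for t
    by (rule linear_map_eqI[OF N bilinear_map_left[OF b] bilinear_map_left[OF c] _ u])
      (use basis t in auto)
qed

text \<open>With four different bilinear maps this covers associativity of one product, the interchange
  of two products, and the case of a product between different free modules.\<close>

lemma bilinear_assoc_eqI:
  assumes N: "module R N"
    and b1: "b1 \<in> bilinear_map R (free_module R S) (free_module R T) M"
    and b2: "b2 \<in> bilinear_map R M (free_module R U) N"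
    and c1: "c1 \<in> bilinear_map R (free_module R T) (free_module R U) M'"
    and c2: "c2 \<in> bilinear_map R (free_module R S) M' N"
    and basis: "\<And>s t r. \<lbrakk>s \<in> S; t \<in> T; r \<in> U\<rbrakk>
      \<Longrightarrow> b2 (b1 (basis_elem R s) (basis_elem R t)) (basis_elem R r)
        = c2 (basis_elem R s) (c1 (basis_elem R t) (basis_elem R r))"
    and u: "u \<in> carrier (free_module R S)" and v: "v \<in> carrier (free_module R T)"
    and w: "w \<in> carrier (free_module R U)"
  shows "b2 (b1 u v) w = c2 u (c1 v w)"
proof (rule linear_map_eqI[OF N _ _ _ w])
  show "(\<lambda>w. b2 (b1 u v) w) \<in> linear_map R (free_module R U) N"
    by (rule bilinear_map_right[OF b2 bilinear_map_closed[OF b1 u v]])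
  show "(\<lambda>w. c2 u (c1 v w)) \<in> linear_map R (free_module R U) N"
    by (rule linear_map_comp[OF bilinear_map_right[OF c2 u] bilinear_map_right[OF c1 v]])
  fix r assume r: "r \<in> U"
  show "b2 (b1 u v) (basis_elem R r) = c2 u (c1 v (basis_elem R r))"
  proof (rule bilinear_map_eqI[OF N _ _ _ u v])
    show "(\<lambda>u v. b2 (b1 u v) (basis_elem R r))
        \<in> bilinear_map R (free_module R S) (free_module R T) N"
      by (rule linear_bilinear_map_comp[OF bilinear_map_left[OF b2 basis_elem_closed[OF r]] b1])
    show "(\<lambda>u v. c2 u (c1 v (basis_elem R r)))
        \<in> bilinear_map R (free_module R S) (free_module R T) N"
      by (rule bilinear_map_comp[OF c2 linear_map_id bilinear_map_left[OF c1 basis_elem_closed[OF r]]])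
  qed (use basis r in auto)
qed

text \<open>The counterpart of \<open>lin_ext_linear_free\<close>: the structure constants decide in which submodule the
  product lies. This yields at once that the product respects the number of leaves and
  ladder-freeness.\<close>

lemma bilin_ext_bilinear_free:
  assumes m: "\<And>s t. s \<in> S \<Longrightarrow> t \<in> T \<Longrightarrow> m s t \<in> carrier (free_module R U)" and "U \<subseteq> U'"
  shows "bilin_ext R (free_module R U') m
    \<in> bilinear_map R (free_module R S) (free_module R T) (free_module R U)"
proof (rule bilinear_map_cong[OF _ free_module_module free_module_module])
  have m': "m s t \<in> carrier (free_module R U')" if "s \<in> S" "t \<in> T" for s t
    using m[OF that] free_module_mono[OF assms(2)] by blast
  show small: "bilin_ext R (free_module R U) m
      \<in> bilinear_map R (free_module R S) (free_module R T) (free_module R U)"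
    by (rule bilin_ext_bilinear[OF free_module_module m])
  show "bilin_ext R (free_module R U') m u v = bilin_ext R (free_module R U) m u v"
    if "u \<in> carrier (free_module R S)" "v \<in> carrier (free_module R T)" for u v
    by (rule bilinear_map_eqI[OF free_module_module bilin_ext_bilinear[OF free_module_module m']
          bilinear_map_free_mono[OF small assms(2)] _ that])
      (simp_all add: bilin_ext_basis free_module_module m m')
qed

lemma rota_baxter_on_basis:
  assumes b: "b \<in> bilinear_map R (free_module R S) (free_module R S) (free_module R S)"
    and P: "P \<in> linear_map R (free_module R S) (free_module R S)" and lam: "lam \<in> carrier R"
    and basis: "\<And>s t. \<lbrakk>s \<in> S; t \<in> S\<rbrakk> \<Longrightarrow>
      b (P (basis_elem R s)) (P (basis_elem R t)) =
      P (b (P (basis_elem R s)) (basis_elem R t)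
        \<oplus>\<^bsub>free_module R S\<^esub> b (basis_elem R s) (P (basis_elem R t))
        \<oplus>\<^bsub>free_module R S\<^esub> lam \<odot>\<^bsub>free_module R S\<^esub> b (basis_elem R s) (basis_elem R t))"
    and u: "u \<in> carrier (free_module R S)" and v: "v \<in> carrier (free_module R S)"
  shows "b (P u) (P v) =
      P (b (P u) v \<oplus>\<^bsub>free_module R S\<^esub> b u (P v)
        \<oplus>\<^bsub>free_module R S\<^esub> lam \<odot>\<^bsub>free_module R S\<^esub> b u v)"
proof (rule bilinear_map_eqI[OF free_module_module _ _ _ u v])
  show "(\<lambda>u v. b (P u) (P v))
      \<in> bilinear_map R (free_module R S) (free_module R S) (free_module R S)"
    by (rule bilinear_map_comp[OF b P P])
  show "(\<lambda>u v. P (b (P u) v \<oplus>\<^bsub>free_module R S\<^esub> b u (P v)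
        \<oplus>\<^bsub>free_module R S\<^esub> lam \<odot>\<^bsub>free_module R S\<^esub> b u v))
      \<in> bilinear_map R (free_module R S) (free_module R S) (free_module R S)"
    by (intro linear_bilinear_map_comp[OF P] bilinear_map_add_maps[OF free_module_module]
        bilinear_map_smult_map[OF free_module_module lam] bilinear_map_comp[OF b P linear_map_id]
        bilinear_map_comp[OF b linear_map_id P] b)
qed (rule basis)

text \<open>The inductive step of associativity. Put \<open>N(x, y) = P x \<cdot> y + x \<cdot> P y + \<lambda> x \<cdot> y\<close>, so that
  \<open>P x \<cdot> P y = P (N(x, y))\<close>. Applying the Rota--Baxter identity twice on each side gives
  \<open>P (P (N(x, y)) \<cdot> z + N(x, y) \<cdot> P z + \<lambda> N(x, y) \<cdot> z)\<close> on the left and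
  \<open>P (P x \<cdot> N(y, z) + x \<cdot> P (N(y, z)) + \<lambda> x \<cdot> N(y, z))\<close> on the right. After \<open>P (N(x, y))\<close> and
  \<open>P (N(y, z))\<close> are turned back into products, the arguments of \<open>P\<close> are sums of seven products
  each, and these match one by one. In every one of them at least one factor has lost its \<open>P\<close>.\<close>

lemma rota_baxter_assoc_step:
  assumes M: "module R M" and b: "b \<in> bilinear_map R M M M" and P: "P \<in> linear_map R M M"
    and lam: "lam \<in> carrier R"
    and rb: "\<And>x y. \<lbrakk>x \<in> carrier M; y \<in> carrier M\<rbrakk> \<Longrightarrow>
      b (P x) (P y) = P (b (P x) y \<oplus>\<^bsub>M\<^esub> b x (P y) \<oplus>\<^bsub>M\<^esub> lam \<odot>\<^bsub>M\<^esub> b x y)"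
    and xyz: "x \<in> carrier M" "y \<in> carrier M" "z \<in> carrier M"
    and assoc: "b (b x y) z = b x (b y z)"
      "b (b (P x) y) z = b (P x) (b y z)" "b (b x (P y)) z = b x (b (P y) z)"
      "b (b x y) (P z) = b x (b y (P z))" "b (b (P x) (P y)) z = b (P x) (b (P y) z)"
      "b (b (P x) y) (P z) = b (P x) (b y (P z))" "b (b x (P y)) (P z) = b x (b (P y) (P z))"
  shows "b (b (P x) (P y)) (P z) = b (P x) (b (P y) (P z))"
proof -
  interpret module R M by fact
  note closed [simp, intro] = bilinear_map_closed[OF b] linear_map_closed[OF P] lam xyz
  have b_add: "b (s \<oplus>\<^bsub>M\<^esub> t) w = b s w \<oplus>\<^bsub>M\<^esub> b t w" "b w (s \<oplus>\<^bsub>M\<^esub> t) = b w s \<oplus>\<^bsub>M\<^esub> b w t"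
    if "s \<in> carrier M" "t \<in> carrier M" "w \<in> carrier M" for s t w
    using that linear_map_add[OF bilinear_map_left[OF b]] linear_map_add[OF bilinear_map_right[OF b]]
    by auto
  have b_smult: "b (lam \<odot>\<^bsub>M\<^esub> s) w = lam \<odot>\<^bsub>M\<^esub> b s w" "b w (lam \<odot>\<^bsub>M\<^esub> s) = lam \<odot>\<^bsub>M\<^esub> b w s"
    if "s \<in> carrier M" "w \<in> carrier M" for s w
    using that linear_map_smult[OF bilinear_map_left[OF b]]
      linear_map_smult[OF bilinear_map_right[OF b]]
    by auto
  let ?N = "\<lambda>x y. b (P x) y \<oplus>\<^bsub>M\<^esub> b x (P y) \<oplus>\<^bsub>M\<^esub> lam \<odot>\<^bsub>M\<^esub> b x y"
  have N_closed: "?N s t \<in> carrier M" if "s \<in> carrier M" "t \<in> carrier M" for s t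
    using that by auto
  have "b (b (P x) (P y)) (P z) = b (P (?N x y)) (P z)"
    by (simp add: rb)
  also have "\<dots> = P (b (P (?N x y)) z \<oplus>\<^bsub>M\<^esub> b (?N x y) (P z) \<oplus>\<^bsub>M\<^esub> lam \<odot>\<^bsub>M\<^esub> b (?N x y) z)"
    by (rule rb) (auto intro: N_closed)
  also have "P (?N x y) = b (P x) (P y)"
    by (simp add: rb)
  also have "b (b (P x) (P y)) z \<oplus>\<^bsub>M\<^esub> b (?N x y) (P z) \<oplus>\<^bsub>M\<^esub> lam \<odot>\<^bsub>M\<^esub> b (?N x y) z
      = b (P x) (?N y z) \<oplus>\<^bsub>M\<^esub> b x (b (P y) (P z)) \<oplus>\<^bsub>M\<^esub> lam \<odot>\<^bsub>M\<^esub> b x (?N y z)"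
    by (simp add: b_add b_smult assoc smult_r_distr M.a_ac)
  also have "b (P y) (P z) = P (?N y z)"
    by (simp add: rb)
  also have "P (b (P x) (?N y z) \<oplus>\<^bsub>M\<^esub> b x (P (?N y z)) \<oplus>\<^bsub>M\<^esub> lam \<odot>\<^bsub>M\<^esub> b x (?N y z))
      = b (P x) (P (?N y z))"
    by (rule rb[symmetric]) (auto intro: N_closed)
  also have "P (?N y z) = b (P y) (P z)"
    by (simp add: rb)
  finally show ?thesis .
qed

lemma nonunitary_rota_baxter_algebra_on_basis:
  assumes b: "b \<in> bilinear_map R (free_module R S) (free_module R S) (free_module R S)"
    and P: "P \<in> linear_map R (free_module R S) (free_module R S)" and lam: "lam \<in> carrier R"
    and assoc: "\<And>s t r. \<lbrakk>s \<in> S; t \<in> S; r \<in> S\<rbrakk>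
      \<Longrightarrow> b (b (basis_elem R s) (basis_elem R t)) (basis_elem R r)
        = b (basis_elem R s) (b (basis_elem R t) (basis_elem R r))"
    and rb: "\<And>s t. \<lbrakk>s \<in> S; t \<in> S\<rbrakk> \<Longrightarrow>
      b (P (basis_elem R s)) (P (basis_elem R t)) =
      P (b (P (basis_elem R s)) (basis_elem R t)
        \<oplus>\<^bsub>free_module R S\<^esub> b (basis_elem R s) (P (basis_elem R t))
        \<oplus>\<^bsub>free_module R S\<^esub> lam \<odot>\<^bsub>free_module R S\<^esub> b (basis_elem R s) (basis_elem R t))"
  shows "nonunitary_rota_baxter_algebra R lam ((free_module R S)\<lparr>mult := b\<rparr>) P"
proof -
  interpret F: module R "free_module R S" by (rule free_module_module)
  have "module R ((free_module R S)\<lparr>mult := b\<rparr>)"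
    using free_module_module[of S]
    by (simp add: module_def abelian_group_def abelian_monoid_def abelian_group_axioms_def
        module_axioms_def)
  moreover have "b (b u v) w = b u (b v w)"
    if "u \<in> carrier (free_module R S)" "v \<in> carrier (free_module R S)"
      "w \<in> carrier (free_module R S)" for u v w
    by (rule bilinear_assoc_eqI[OF free_module_module b b b b _ that]) (rule assoc)
  then have "nonunitary_algebra_axioms R ((free_module R S)\<lparr>mult := b\<rparr>)"
    using bilinear_map_closed[OF b]
      linear_map_add[OF bilinear_map_left[OF b]] linear_map_add[OF bilinear_map_right[OF b]]
      linear_map_smult[OF bilinear_map_left[OF b]] linear_map_smult[OF bilinear_map_right[OF b]]
    by unfold_locales simp_all
  moreover have "b (P u) (P v) =
      P (b (P u) v \<oplus>\<^bsub>free_module R S\<^esub> b u (P v)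
        \<oplus>\<^bsub>free_module R S\<^esub> lam \<odot>\<^bsub>free_module R S\<^esub> b u v)"
    if "u \<in> carrier (free_module R S)" "v \<in> carrier (free_module R S)" for u v
    by (rule rota_baxter_on_basis[OF b P lam _ that]) (rule rb)
  then have "nonunitary_rota_baxter_algebra_axioms R lam ((free_module R S)\<lparr>mult := b\<rparr>) P"
    using linear_map_closed[OF P] linear_map_add[OF P]
      linear_map_smult[OF P] lam
    by unfold_locales simp_all
  ultimately show ?thesis
    by (intro nonunitary_rota_baxter_algebra.intro nonunitary_algebra.intro)
qed

end

section \<open>The diamond product of forests\<close>

declare tree_prod.simps [simp del] forest_prod.simps [simp del]

lemma mem_forests [simp]: "F \<in> forests \<longleftrightarrow> F \<noteq> []"
  by (simp add: forests_def)

lemma tree_leaves_Node: "F \<noteq> [] \<Longrightarrow> tree_leaves (Node F) = leaves F"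
  by (simp add: leaves_def)

lemma leaves_simps [simp]:
  "leaves [] = 0" "leaves (T # F) = tree_leaves T + leaves F" "leaves (F @ G) = leaves F + leaves G"
  by (simp_all add: leaves_def)

lemma tree_leaves_pos: "tree_leaves T \<ge> 1"
proof (induction T)
  case (Node F)
  show ?case
  proof (cases F)
    case (Cons U G)
    with Node[of U] show ?thesis by simp
  qed simp
qed

lemma leaves_pos: "F \<noteq> [] \<Longrightarrow> leaves F \<ge> 1"
  using tree_leaves_pos[of "hd F"] by (cases F) auto

lemma tree_prod_bullet_right: "tree_prod k lam T bullet = basis_elem k [T]"
  by (cases T) (simp add: tree_prod.simps)

lemma tree_prod_bullet_left: "tree_prod k lam bullet T = basis_elem k [T]"
  by (cases T) (auto simp add: tree_prod.simps)

lemma tree_prod_Node: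
  "\<lbrakk>F \<noteq> []; G \<noteq> []\<rbrakk> \<Longrightarrow> tree_prod k lam (Node F) (Node G) =
    graft k (forest_prod k lam [Node F] G)
       \<oplus>\<^bsub>forest_module k\<^esub> graft k (forest_prod k lam F [Node G])
       \<oplus>\<^bsub>forest_module k\<^esub> lam \<odot>\<^bsub>forest_module k\<^esub> graft k (forest_prod k lam F G)"
  by (simp add: tree_prod.simps)

lemma forest_prod_nonempty:
  "\<lbrakk>F \<noteq> []; G \<noteq> []\<rbrakk> \<Longrightarrow> forest_prod k lam F G =
    lin_ext k (forest_module k) (\<lambda>H. basis_elem k (butlast F @ H @ tl G))
       (tree_prod k lam (last F) (hd G))"
  by (simp add: forest_prod.simps)

text \<open>The recursion of \<open>\<diamond>\<close> as an induction rule on pairs of nonempty forests alone, with a tree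
  represented by the forest consisting of it.\<close>

lemma diamond_induct [consumes 2, case_names bullet_right bullet_left grafts forests]:
  assumes "F \<noteq> []" and "G \<noteq> []"
    and "\<And>T. Q [T] [bullet]" and "\<And>U. Q [bullet] [U]"
    and "\<And>F G. \<lbrakk>F \<noteq> []; G \<noteq> []; Q [Node F] G; Q F [Node G]; Q F G\<rbrakk> \<Longrightarrow> Q [Node F] [Node G]"
    and "\<And>F G. \<lbrakk>F \<noteq> []; G \<noteq> []; Q [last F] [hd G]\<rbrakk> \<Longrightarrow> Q F G"
  shows "Q F G"
proof -
  have "F \<noteq> [] \<longrightarrow> G \<noteq> [] \<longrightarrow> Q F G"
  proof (rule tree_prod_forest_prod.induct(2)[where P = "\<lambda>(_ :: (unit, unit) ring_scheme) _ T U. Q [T] [U]"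
        and Q = "\<lambda>_ _ F G. F \<noteq> [] \<longrightarrow> G \<noteq> [] \<longrightarrow> Q F G"], goal_cases)
    case (1 k lam F G)
    show ?case
    proof (cases "F = [] \<or> G = []")
      case True
      then show ?thesis using assms(3,4) by auto
    next
      case False
      then show ?thesis using 1 by (intro assms(5)) auto
    qed
  next
    case (2 k lam F G)
    then show ?case using assms(6) by auto
  qed
  with assms(1,2) show ?thesis by simp
qed

text \<open>Supersets of the forests that occur in a product of two trees, or of two forests. The product of
  two trees is a combination of single trees, and \<open>\<bullet>\<close> occurs only in \<open>\<bullet> \<diamond> \<bullet>\<close>; the latter is needed to
  stay away from the forest \<open>[\<bullet>]\<close>, and hence from ladders after grafting. The subtraction does not
  truncate, as every tree has a leaf.\<close>

definition tree_targets :: "ptree \<Rightarrow> ptree \<Rightarrow> ptree list set" where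
  "tree_targets T U = {[W] | W. tree_leaves W = tree_leaves T + tree_leaves U - 1
    \<and> (ladder_free T \<and> ladder_free U \<longrightarrow> ladder_free W)
    \<and> (W = bullet \<longrightarrow> T = bullet \<and> U = bullet)}"

definition forest_targets :: "ptree list \<Rightarrow> ptree list \<Rightarrow> ptree list set" where
  "forest_targets F G = {H \<in> forests. leaves H = leaves F + leaves G - 1
    \<and> (F \<in> ladder_free_forests \<and> G \<in> ladder_free_forests \<longrightarrow> H \<in> ladder_free_forests)}"

lemma tree_targets_subset_forests: "tree_targets T U \<subseteq> forests"
  by (auto simp: tree_targets_def)

lemma forest_targets_subset_forests: "forest_targets F G \<subseteq> forests"
  by (auto simp: forest_targets_def)

lemma ladder_free_forests_subset: "ladder_free_forests \<subseteq> forests"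
  by (auto simp: ladder_free_forests_def)

lemma ladder_free_Node: "F \<noteq> [] \<Longrightarrow> ladder_free (Node F) \<longleftrightarrow> F \<in> ladder_free_forests"
  by (auto simp: ladder_free_forests_def)

text \<open>Two factors \<open>F\<close> and \<open>G\<close> different from \<open>[\<bullet>]\<close> cannot produce \<open>[\<bullet>]\<close>: if both trees that are
  multiplied are \<open>\<bullet>\<close>, then some other tree of \<open>F\<close> or \<open>G\<close> remains beside the result.\<close>

lemma padded_in_forest_targets:
  assumes "F \<noteq> []" and "G \<noteq> []" and "H \<in> tree_targets (last F) (hd G)"
  shows "butlast F @ H @ tl G \<in> forest_targets F G"
proof -
  obtain W where W: "H = [W]" "tree_leaves W = tree_leaves (last F) + tree_leaves (hd G) - 1"
    "ladder_free (last F) \<and> ladder_free (hd G) \<longrightarrow> ladder_free W"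
    "W = bullet \<longrightarrow> last F = bullet \<and> hd G = bullet"
    using assms(3) by (auto simp: tree_targets_def)
  obtain A T where F: "F = A @ [T]" using assms(1) by (cases F rule: rev_cases) auto
  obtain U B where G: "G = U # B" using assms(2) by (cases G) auto
  have "leaves (A @ [W] @ B) = leaves F + leaves G - 1"
    using W(2) F G tree_leaves_pos[of T] tree_leaves_pos[of U] by simp
  then show ?thesis
    using W F G
    by (auto simp: forest_targets_def ladder_free_forests_def append_eq_Cons_conv)
qed

locale scalars = cring k for k (structure) +
  fixes lam
  assumes lam_closed: "lam \<in> carrier k"
begin

lemmas FM_module = free_module_module[of forests]

lemma graft_linear:
  assumes "\<And>F. F \<in> S \<Longrightarrow> [Node F] \<in> T" and "T \<subseteq> forests"
  shows "graft k \<in> linear_map k (free_module k S) (free_module k T)"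
  unfolding graft_def
  by (rule lin_ext_linear_free) (use assms in auto)

lemma graft_linear_forests: "graft k \<in> linear_map k (forest_module k) (forest_module k)"
  by (rule graft_linear) auto

lemma graft_basis: "graft k (basis_elem k F) = basis_elem k [Node F]"
  unfolding graft_def
  by (rule lin_ext_basis[OF FM_module]) simp

lemma forest_prod_closed_from_tree_prod:
  assumes "F \<noteq> []" and "G \<noteq> []"
    and "tree_prod k lam (last F) (hd G) \<in> carrier (free_module k (tree_targets (last F) (hd G)))"
  shows "forest_prod k lam F G \<in> carrier (free_module k (forest_targets F G))"
  unfolding forest_prod_nonempty[OF assms(1,2)]
  by (rule linear_map_closed[OF lin_ext_linear_free assms(3)])
    (use padded_in_forest_targets[OF assms(1,2)] forest_targets_subset_forests in auto)

lemma rota_baxter_sum_closed: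
  assumes "u \<in> carrier (free_module k S)" and "v \<in> carrier (free_module k S)"
    and "w \<in> carrier (free_module k S)"
  shows "u \<oplus>\<^bsub>free_module k T\<^esub> v \<oplus>\<^bsub>free_module k T\<^esub> lam \<odot>\<^bsub>free_module k T\<^esub> w
    \<in> carrier (free_module k S)"
  unfolding free_module_ops
  using assms lam_closed by (intro free_add_closed free_smult_closed)

text \<open>The trees occurring in a product of two grafts are grafts of forests from products of smaller
  pairs. All three pairs have the same total number of leaves, since grafting preserves it, and all
  three consist of ladder-free forests if the two trees are ladder-free.\<close>

lemma forest_prod_closed:
  assumes "F \<noteq> []" and "G \<noteq> []"
  shows "forest_prod k lam F G \<in> carrier (free_module k (forest_targets F G))
    \<and> (\<forall>T U. F = [T] \<longrightarrow> G = [U] \<longrightarrow>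
        tree_prod k lam T U \<in> carrier (free_module k (tree_targets T U)))"
  using assms
proof (induction F G rule: diamond_induct)
  case (bullet_right T)
  have *: "tree_prod k lam T bullet \<in> carrier (free_module k (tree_targets T bullet))"
    by (auto simp: tree_prod_bullet_right tree_targets_def)
  then show ?case using forest_prod_closed_from_tree_prod[of "[T]" "[bullet]"] by simp
next
  case (bullet_left T)
  have *: "tree_prod k lam bullet T \<in> carrier (free_module k (tree_targets bullet T))"
    by (auto simp: tree_prod_bullet_left tree_targets_def)
  then show ?case using forest_prod_closed_from_tree_prod[of "[bullet]" "[T]"] by simp
next
  case (grafts F G)
  have graft_closed: "graft k u \<in> carrier (free_module k (tree_targets (Node F) (Node G)))"
    if "u \<in> carrier (free_module k (forest_targets F' G'))"
      and "leaves F' + leaves G' = tree_leaves (Node F) + tree_leaves (Node G)"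
      and "ladder_free (Node F) \<and> ladder_free (Node G)
        \<longrightarrow> F' \<in> ladder_free_forests \<and> G' \<in> ladder_free_forests"
    for u F' G'
    by (rule linear_map_closed[OF graft_linear that(1)])
      (use that(2,3) tree_targets_subset_forests in
        \<open>auto simp: tree_targets_def forest_targets_def ladder_free_Node tree_leaves_Node
          simp del: tree_leaves.simps ladder_free.simps\<close>)
  have "[Node F] \<in> ladder_free_forests" "[Node G] \<in> ladder_free_forests"
    if "ladder_free (Node F)" "ladder_free (Node G)"
    using grafts(1,2) that
    by (simp_all add: ladder_free_forests_def)
  then have *: "tree_prod k lam (Node F) (Node G) \<in> carrier (free_module k (tree_targets (Node F) (Node G)))"
    unfolding tree_prod_Node[OF grafts(1,2)]
    using grafts
    by (intro rota_baxter_sum_closed graft_closed[of _ "[Node F]" G] graft_closed[of _ F "[Node G]"]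
        graft_closed[of _ F G])
      (auto simp: tree_leaves_Node ladder_free_Node simp del: tree_leaves.simps ladder_free.simps)
  then show ?case using forest_prod_closed_from_tree_prod[of "[Node F]" "[Node G]"] by simp
next
  case (forests F G)
  then show ?case using forest_prod_closed_from_tree_prod[OF forests(1,2)] by auto
qed

abbreviation diamond where "diamond \<equiv> bilin_ext k (forest_module k) (forest_prod k lam)"

abbreviation concat_ext where
  "concat_ext \<equiv> bilin_ext k (forest_module k) (\<lambda>F G. basis_elem k (F @ G))"

lemma forest_prod_in_targets:
  "\<lbrakk>F \<in> forests; G \<in> forests\<rbrakk> \<Longrightarrow> forest_prod k lam F G \<in> carrier (free_module k (forest_targets F G))"
  using forest_prod_closed by simp

lemma forest_prod_in_forests:
  "\<lbrakk>F \<in> forests; G \<in> forests\<rbrakk> \<Longrightarrow> forest_prod k lam F G \<in> carrier (forest_module k)"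
  using forest_prod_in_targets free_module_mono[OF forest_targets_subset_forests] by blast

lemma tree_prod_in_targets: "tree_prod k lam T U \<in> carrier (free_module k (tree_targets T U))"
  using forest_prod_closed[of "[T]" "[U]"] by simp

lemma tree_prod_in_forests: "tree_prod k lam T U \<in> carrier (forest_module k)"
  using tree_prod_in_targets free_module_mono[OF tree_targets_subset_forests] by blast

lemma diamond_bilinear:
  "diamond \<in> bilinear_map k (forest_module k) (forest_module k) (forest_module k)"
  by (rule bilin_ext_bilinear[OF FM_module forest_prod_in_forests])

lemma concat_ext_bilinear:
  "concat_ext \<in> bilinear_map k (forest_module k) (forest_module k) (forest_module k)"
  by (rule bilin_ext_bilinear[OF FM_module]) simp

lemma diamond_basis:
  "\<lbrakk>F \<in> forests; G \<in> forests\<rbrakk> \<Longrightarrow> diamond (basis_elem k F) (basis_elem k G) = forest_prod k lam F G"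
  by (simp add: bilin_ext_basis FM_module forest_prod_in_forests)

lemma concat_ext_basis:
  "\<lbrakk>F \<in> forests; G \<in> forests\<rbrakk> \<Longrightarrow> concat_ext (basis_elem k F) (basis_elem k G) = basis_elem k (F @ G)"
  by (simp add: bilin_ext_basis FM_module)

lemma forest_prod_singletons: "forest_prod k lam [T] [U] = tree_prod k lam T U"
  by (simp add: forest_prod_nonempty lin_ext_basis_elem_self[OF tree_prod_in_forests])

lemma pad_linear:
  "lin_ext k (forest_module k) (\<lambda>H. basis_elem k (A @ H @ B)) \<in> linear_map k (forest_module k) (forest_module k)"
  by (rule lin_ext_linear[OF FM_module]) simp

text \<open>Only the trees at the junction of two forests interact, so a forest appended on the right of the
  second factor, or on the left of the first one, is carried along. The linear extension of
  concatenation expresses this without reference to the shape of the forests.\<close>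

lemma forest_prod_append_right:
  assumes "F \<in> forests" and "G \<in> forests" and "H \<in> forests"
  shows "forest_prod k lam F (G @ H) = concat_ext (forest_prod k lam F G) (basis_elem k H)"
proof -
  have ne: "F \<noteq> []" "G \<noteq> []" "G @ H \<noteq> []" using assms by auto
  show ?thesis
    unfolding forest_prod_nonempty[OF ne(1,2)] forest_prod_nonempty[OF ne(1,3)] hd_append2[OF ne(2)]
  proof (rule linear_map_eqI[OF FM_module pad_linear _ _ tree_prod_in_forests])
    show "(\<lambda>u. concat_ext (lin_ext k (forest_module k) (\<lambda>H. basis_elem k (butlast F @ H @ tl G)) u)
        (basis_elem k H)) \<in> linear_map k (forest_module k) (forest_module k)"
      by (rule linear_map_comp[OF bilinear_map_left[OF concat_ext_bilinear] pad_linear])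
        (use assms in simp)
  qed (use assms ne in \<open>simp add: lin_ext_basis[OF FM_module] concat_ext_basis\<close>)
qed

lemma forest_prod_append_left:
  assumes "F \<in> forests" and "G \<in> forests" and "H \<in> forests"
  shows "forest_prod k lam (F @ G) H = concat_ext (basis_elem k F) (forest_prod k lam G H)"
proof -
  have ne: "G \<noteq> []" "H \<noteq> []" "F @ G \<noteq> []" using assms by auto
  show ?thesis
    unfolding forest_prod_nonempty[OF ne(1,2)] forest_prod_nonempty[OF ne(3,2)] last_appendR[OF ne(1)]
  proof (rule linear_map_eqI[OF FM_module pad_linear _ _ tree_prod_in_forests])
    show "(\<lambda>u. concat_ext (basis_elem k F)
        (lin_ext k (forest_module k) (\<lambda>K. basis_elem k (butlast G @ K @ tl H)) u))
        \<in> linear_map k (forest_module k) (forest_module k)"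
      by (rule linear_map_comp[OF bilinear_map_right[OF concat_ext_bilinear] pad_linear])
        (use assms in simp)
  qed (use assms ne in \<open>simp add: lin_ext_basis[OF FM_module] concat_ext_basis butlast_append\<close>)
qed

lemma diamond_concat_right:
  assumes "u \<in> carrier (forest_module k)" "v \<in> carrier (forest_module k)" "w \<in> carrier (forest_module k)"
  shows "concat_ext (diamond u v) w = diamond u (concat_ext v w)"
  by (rule bilinear_assoc_eqI[OF FM_module diamond_bilinear concat_ext_bilinear concat_ext_bilinear
        diamond_bilinear _ assms])
    (simp add: diamond_basis concat_ext_basis forest_prod_append_right)

lemma concat_diamond_left:
  assumes "u \<in> carrier (forest_module k)" "v \<in> carrier (forest_module k)" "w \<in> carrier (forest_module k)"
  shows "diamond (concat_ext u v) w = concat_ext u (diamond v w)"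
  by (rule bilinear_assoc_eqI[OF FM_module concat_ext_bilinear diamond_bilinear diamond_bilinear
        concat_ext_bilinear _ assms])
    (simp add: diamond_basis concat_ext_basis forest_prod_append_left)

lemma diamond_rota_baxter:
  assumes "u \<in> carrier (forest_module k)" "v \<in> carrier (forest_module k)"
  shows "diamond (graft k u) (graft k v) =
    graft k (diamond (graft k u) v \<oplus>\<^bsub>forest_module k\<^esub> diamond u (graft k v)
      \<oplus>\<^bsub>forest_module k\<^esub> lam \<odot>\<^bsub>forest_module k\<^esub> diamond u v)"
proof (rule rota_baxter_on_basis[OF diamond_bilinear graft_linear_forests lam_closed _ assms])
  fix F G assume FG: "F \<in> forests" "G \<in> forests"
  interpret FM: module k "forest_module k" by (rule FM_module)
  have [simp]: "[Node F] \<in> forests" "[Node G] \<in> forests" by simp_all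
  note cl = forest_prod_in_forests
  show "diamond (graft k (basis_elem k F)) (graft k (basis_elem k G)) =
    graft k (diamond (graft k (basis_elem k F)) (basis_elem k G)
      \<oplus>\<^bsub>forest_module k\<^esub> diamond (basis_elem k F) (graft k (basis_elem k G))
      \<oplus>\<^bsub>forest_module k\<^esub> lam \<odot>\<^bsub>forest_module k\<^esub> diamond (basis_elem k F) (basis_elem k G))"
    using FG lam_closed
    by (simp add: graft_basis diamond_basis forest_prod_singletons tree_prod_Node cl
        linear_map_add[OF graft_linear_forests] linear_map_smult[OF graft_linear_forests])
qed

lemma diamond_bullet_right:
  assumes "u \<in> carrier (forest_module k)"
  shows "diamond u (basis_elem k [bullet]) = u"
proof (rule linear_map_eqI[OF FM_module bilinear_map_left[OF diamond_bilinear] linear_map_id _ assms])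
  fix F :: "ptree list" assume F: "F \<in> forests"
  then show "diamond (basis_elem k F) (basis_elem k [bullet]) = basis_elem k F"
    by (simp add: diamond_basis forest_prod_nonempty tree_prod_bullet_right
        lin_ext_basis FM_module)
qed simp

lemma diamond_bullet_left:
  assumes "u \<in> carrier (forest_module k)"
  shows "diamond (basis_elem k [bullet]) u = u"
proof (rule linear_map_eqI[OF FM_module bilinear_map_right[OF diamond_bilinear] linear_map_id _ assms])
  fix F :: "ptree list" assume F: "F \<in> forests"
  then show "diamond (basis_elem k [bullet]) (basis_elem k F) = basis_elem k F"
    by (simp add: diamond_basis forest_prod_nonempty tree_prod_bullet_left
        lin_ext_basis FM_module)
qed simp

text \<open>If the middle forest has at least two trees, the two junctions do not interact. Otherwise a
  decomposable outer forest is reduced by the induction hypothesis, and three single trees remain.\<close>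

lemma diamond_assoc_basis:
  assumes "F \<in> forests" and "G \<in> forests" and "H \<in> forests"
  shows "diamond (diamond (basis_elem k F) (basis_elem k G)) (basis_elem k H)
    = diamond (basis_elem k F) (diamond (basis_elem k G) (basis_elem k H))"
  using assms
proof (induction "size_list size F + size_list size G + size_list size H" arbitrary: F G H
    rule: less_induct)
  case less
  let ?b = "basis_elem k"
  note dc = bilinear_map_closed[OF diamond_bilinear]
  have b: "?b F \<in> carrier (forest_module k)" if "F \<in> forests" for F using that by simp
  have split: "\<exists>A B. K = A @ B \<and> A \<in> forests \<and> B \<in> forests
      \<and> size_list size A < size_list size K \<and> size_list size B < size_list size K"
    if K: "K \<in> forests" "\<nexists>T. K = [T]" for K :: "ptree list"
  proof -
    obtain T U A where "K = T # U # A"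
      using K by (cases K; cases "tl K") auto
    then show ?thesis
      by (intro exI[of _ "[T]"] exI[of _ "U # A"]) auto
  qed
  \<comment> \<open>An outer forest may be split anywhere; the part next to the middle forest is the smaller instance.\<close>
  consider A B where "F = A @ B" "A \<in> forests" "B \<in> forests" "size_list size B < size_list size F"
    | A B where "H = A @ B" "A \<in> forests" "B \<in> forests" "size_list size A < size_list size H"
    | A B where "G = A @ B" "A \<in> forests" "B \<in> forests"
    | T U V where "F = [T]" "G = [U]" "H = [V]"
    using split less.prems by metis
  then show ?case
  proof cases
    case (1 A B)
    have IH: "diamond (diamond (?b B) (?b G)) (?b H) = diamond (?b B) (diamond (?b G) (?b H))"
      by (rule less.hyps) (use 1 less.prems in auto)
    have "?b F = concat_ext (?b A) (?b B)" using 1 by (simp add: concat_ext_basis)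
    then show ?thesis
      using 1 less.prems IH by (simp add: concat_diamond_left dc b)
  next
    case (2 A B)
    have IH: "diamond (diamond (?b F) (?b G)) (?b A) = diamond (?b F) (diamond (?b G) (?b A))"
      by (rule less.hyps) (use 2 less.prems in auto)
    have "?b H = concat_ext (?b A) (?b B)" using 2 by (simp add: concat_ext_basis)
    then show ?thesis
      using 2 less.prems IH by (simp add: diamond_concat_right[symmetric] dc b)
  next
    case (3 A B)
    have "?b G = concat_ext (?b A) (?b B)" using 3 by (simp add: concat_ext_basis)
    then show ?thesis
      using 3 less.prems
      by (simp add: diamond_concat_right[symmetric] concat_diamond_left dc b)
  next
    case (4 T U V)
    show ?thesis
    proof (cases "T = bullet \<or> U = bullet \<or> V = bullet")
      case True
      then show ?thesis
        using 4 less.prems by (auto simp: diamond_bullet_left diamond_bullet_right dc b)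
    next
      case False
      obtain x y z where xyz: "T = Node x" "U = Node y" "V = Node z"
        by (meson ptree.exhaust)
      with False have ne: "x \<in> forests" "y \<in> forests" "z \<in> forests"
        by auto
      have graft: "graft k (?b x) = ?b F" "graft k (?b y) = ?b G" "graft k (?b z) = ?b H"
        using 4 xyz by (simp_all add: graft_basis)
      have size: "size_list size x < size_list size F" "size_list size y < size_list size G"
        "size_list size z < size_list size H"
        using 4 xyz by simp_all
      have IH: "diamond (diamond (?b A) (?b B)) (?b C) = diamond (?b A) (diamond (?b B) (?b C))"
        if "A \<in> {x, F}" "B \<in> {y, G}" "C \<in> {z, H}" "A = x \<or> B = y \<or> C = z" for A B C
        by (rule less.hyps) (use that size ne less.prems in auto)
      show ?thesis
        using rota_baxter_assoc_step[of "forest_module k" diamond "graft k" lam "?b x" "?b y" "?b z",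
            OF FM_module diamond_bilinear graft_linear_forests lam_closed diamond_rota_baxter
              b[OF ne(1)] b[OF ne(2)] b[OF ne(3)], unfolded graft]
        by (simp add: IH)
    qed
  qed
qed

end

section \<open>The Rota--Baxter algebra of decorated ladder-free forests\<close>

text \<open>The ladder-free forests that carry \<open>n\<close> decorations. Decorating by a fixed tuple is linear only on
  combinations of forests with the matching number of leaves, so products are followed through
  these graded pieces.\<close>

definition graded_ladder_free :: "nat \<Rightarrow> ptree list set" where
  "graded_ladder_free n = {F \<in> ladder_free_forests. leaves F = Suc n}"

lemma graded_ladder_free_subset: "graded_ladder_free n \<subseteq> forests"
  using ladder_free_forests_subset by (auto simp: graded_ladder_free_def)

lemma decorated_ladder_free_subset:
  "decorated X ladder_free_forests \<subseteq> decorated X forests"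
  using ladder_free_forests_subset by (auto simp: decorated_def)

lemma decorated_ladder_free_iff:
  "(F, xs) \<in> decorated X ladder_free_forests \<longleftrightarrow>
    F \<in> graded_ladder_free (length xs) \<and> set xs \<subseteq> X"
proof -
  have "leaves F \<ge> 1" if "F \<in> ladder_free_forests"
    using that ladder_free_forests_subset leaves_pos by auto
  then show ?thesis by (auto simp: decorated_def graded_ladder_free_def)
qed

lemma graft_ladder_free: "F \<in> ladder_free_forests \<Longrightarrow> [Node F] \<in> ladder_free_forests"
  by (auto simp: ladder_free_forests_def)

lemma graft_graded: "F \<in> graded_ladder_free n \<Longrightarrow> [Node F] \<in> graded_ladder_free n"
  using graded_ladder_free_subset[of n]
  by (auto simp: graded_ladder_free_def graft_ladder_free tree_leaves_Node
      simp del: tree_leaves.simps)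

lemma ShNC0_eq:
  "ShNC0 k lam X = (free_module k (decorated X ladder_free_forests))\<lparr>mult := dec_prod k lam X\<rparr>"
  by (simp add: ShNC0_def ShNC_def free_module_def)

context scalars
begin

text \<open>The free modules \<open>free_module k S\<close> and \<open>free_module k T\<close> have the same addition, which allows the
  sum to be written in one of them and the linear map to be defined on the other.\<close>

lemma linear_map_rota_baxter_sum:
  assumes h: "h \<in> linear_map k (free_module k S) M"
    and u: "u \<in> carrier (free_module k S)" "v \<in> carrier (free_module k S)"
      "w \<in> carrier (free_module k S)"
  shows "h (u \<oplus>\<^bsub>free_module k T\<^esub> v \<oplus>\<^bsub>free_module k T\<^esub> lam \<odot>\<^bsub>free_module k T\<^esub> w)
    = h u \<oplus>\<^bsub>M\<^esub> h v \<oplus>\<^bsub>M\<^esub> lam \<odot>\<^bsub>M\<^esub> h w"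
proof -
  interpret S: module k "free_module k S" by (rule free_module_module)
  have "h (u \<oplus>\<^bsub>free_module k S\<^esub> v \<oplus>\<^bsub>free_module k S\<^esub> lam \<odot>\<^bsub>free_module k S\<^esub> w)
    = h u \<oplus>\<^bsub>M\<^esub> h v \<oplus>\<^bsub>M\<^esub> lam \<odot>\<^bsub>M\<^esub> h w"
    using u lam_closed by (simp add: linear_map_add[OF h] linear_map_smult[OF h])
  then show ?thesis by (simp only: free_module_ops)
qed

lemma diamond_graded:
  "diamond \<in> bilinear_map k (free_module k (graded_ladder_free m))
    (free_module k (graded_ladder_free n)) (free_module k (graded_ladder_free (m + n)))"
proof (rule bilin_ext_bilinear_free[OF _ graded_ladder_free_subset])
  fix F G assume F: "F \<in> graded_ladder_free m" and G: "G \<in> graded_ladder_free n"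
  then have "forest_targets F G \<subseteq> graded_ladder_free (m + n)"
    by (auto simp: forest_targets_def graded_ladder_free_def)
  moreover have "forest_prod k lam F G \<in> carrier (free_module k (forest_targets F G))"
    by (rule forest_prod_in_targets) (use F G graded_ladder_free_subset in blast)+
  ultimately show "forest_prod k lam F G \<in> carrier (free_module k (graded_ladder_free (m + n)))"
    using free_module_mono by blast
qed

lemma graft_graded_linear:
  "graft k \<in> linear_map k (free_module k (graded_ladder_free n)) (free_module k (graded_ladder_free n))"
  by (rule graft_linear[OF graft_graded graded_ladder_free_subset])

lemma decorate_linear:
  assumes "set xs \<subseteq> X"
  shows "(\<lambda>u. decorate k X u xs) \<in> linear_map k (free_module k (graded_ladder_free (length xs)))
    (free_module k (decorated X ladder_free_forests))"
  unfolding decorate_def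
  by (rule lin_ext_linear_free[OF _ decorated_ladder_free_subset])
    (use assms in \<open>auto simp: decorated_ladder_free_iff\<close>)

lemma decorate_basis:
  assumes "(F, xs) \<in> decorated X ladder_free_forests"
  shows "decorate k X (basis_elem k F) xs = basis_elem k (F, xs)"
  unfolding decorate_def
  by (rule lin_ext_basis[OF free_module_module])
    (rule basis_elem_closed[OF subsetD[OF decorated_ladder_free_subset assms]])

lemma dec_prod_eq:
  "dec_prod k lam X = bilin_ext k (dec_module k X)
    (\<lambda>s t. decorate k X (forest_prod k lam (fst s) (fst t)) (snd s @ snd t))"
  by (simp add: fun_eq_iff dec_prod_def bilin_ext_def split_def)

lemma decorated_forest_prod_closed:
  assumes "(F, xs) \<in> decorated X ladder_free_forests" and "(G, ys) \<in> decorated X ladder_free_forests"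
  shows "decorate k X (forest_prod k lam F G) (xs @ ys)
    \<in> carrier (free_module k (decorated X ladder_free_forests))"
proof (rule linear_map_closed[OF decorate_linear])
  show "set (xs @ ys) \<subseteq> X" using assms by (auto simp: decorated_def)
  have F: "F \<in> graded_ladder_free (length xs)" and G: "G \<in> graded_ladder_free (length ys)"
    using assms by (simp_all add: decorated_ladder_free_iff)
  have "forest_prod k lam F G = diamond (basis_elem k F) (basis_elem k G)"
    using F G graded_ladder_free_subset by (metis diamond_basis subsetD)
  then show "forest_prod k lam F G \<in> carrier (free_module k (graded_ladder_free (length (xs @ ys))))"
    using bilinear_map_closed[OF diamond_graded, OF basis_elem_closed[OF F] basis_elem_closed[OF G]]
    by simp
qed

lemma dec_prod_bilinear:
  "dec_prod k lam X \<in> bilinear_map k (free_module k (decorated X ladder_free_forests))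
    (free_module k (decorated X ladder_free_forests)) (free_module k (decorated X ladder_free_forests))"
  unfolding dec_prod_eq
  by (rule bilin_ext_bilinear_free[OF _ decorated_ladder_free_subset])
    (metis decorated_forest_prod_closed prod.collapse)

lemma dec_prod_basis:
  assumes "(F, xs) \<in> decorated X ladder_free_forests" and "(G, ys) \<in> decorated X ladder_free_forests"
  shows "dec_prod k lam X (basis_elem k (F, xs)) (basis_elem k (G, ys))
    = decorate k X (forest_prod k lam F G) (xs @ ys)"
proof -
  have "decorate k X (forest_prod k lam F G) (xs @ ys) \<in> carrier (dec_module k X)"
    using decorated_forest_prod_closed[OF assms] free_module_mono[OF decorated_ladder_free_subset]
    by blast
  then show ?thesis
    unfolding dec_prod_eq by (simp add: bilin_ext_basis[OF free_module_module])
qed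

text \<open>Decorating turns \<open>\<diamond>\<close> into the product of decorated forests. Together with \<open>dec_op_decorate\<close> this
  transfers associativity and the Rota--Baxter identity from plain forests, the decorations being
  concatenated on both sides.\<close>

lemma dec_prod_decorate:
  assumes xs: "set xs \<subseteq> X" and ys: "set ys \<subseteq> X"
    and u: "u \<in> carrier (free_module k (graded_ladder_free (length xs)))"
    and v: "v \<in> carrier (free_module k (graded_ladder_free (length ys)))"
  shows "dec_prod k lam X (decorate k X u xs) (decorate k X v ys) = decorate k X (diamond u v) (xs @ ys)"
proof (rule bilinear_map_eqI[OF free_module_module _ _ _ u v])
  show "(\<lambda>u v. dec_prod k lam X (decorate k X u xs) (decorate k X v ys))
    \<in> bilinear_map k (free_module k (graded_ladder_free (length xs)))
      (free_module k (graded_ladder_free (length ys)))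
      (free_module k (decorated X ladder_free_forests))"
    by (rule bilinear_map_comp[OF dec_prod_bilinear decorate_linear[OF xs] decorate_linear[OF ys]])
  have "set (xs @ ys) \<subseteq> X" using xs ys by simp
  then show "(\<lambda>u v. decorate k X (diamond u v) (xs @ ys))
    \<in> bilinear_map k (free_module k (graded_ladder_free (length xs)))
      (free_module k (graded_ladder_free (length ys)))
      (free_module k (decorated X ladder_free_forests))"
    by (intro linear_bilinear_map_comp[OF decorate_linear, of "xs @ ys" X diamond])
      (simp_all add: diamond_graded)
next
  fix F G
  assume F: "F \<in> graded_ladder_free (length xs)" and G: "G \<in> graded_ladder_free (length ys)"
  then have "F \<in> forests" "G \<in> forests"
    and "(F, xs) \<in> decorated X ladder_free_forests" "(G, ys) \<in> decorated X ladder_free_forests"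
    using xs ys graded_ladder_free_subset by (auto simp: decorated_ladder_free_iff simp del: mem_forests)
  then show "dec_prod k lam X (decorate k X (basis_elem k F) xs) (decorate k X (basis_elem k G) ys)
      = decorate k X (diamond (basis_elem k F) (basis_elem k G)) (xs @ ys)"
    by (simp add: decorate_basis dec_prod_basis diamond_basis)
qed

lemma dec_op_linear:
  "dec_op k X \<in> linear_map k (free_module k (decorated X ladder_free_forests))
    (free_module k (decorated X ladder_free_forests))"
  unfolding dec_op_def
  by (rule lin_ext_linear_free[OF _ decorated_ladder_free_subset])
    (auto simp: decorated_ladder_free_iff graft_graded)

lemma dec_op_basis:
  assumes "(F, xs) \<in> decorated X ladder_free_forests"
  shows "dec_op k X (basis_elem k (F, xs)) = basis_elem k ([Node F], xs)"
proof -
  have "([Node F], xs) \<in> decorated X forests"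
    by (rule subsetD[OF decorated_ladder_free_subset])
      (use assms in \<open>simp add: decorated_ladder_free_iff graft_graded\<close>)
  then show ?thesis
    unfolding dec_op_def by (simp add: lin_ext_basis[OF free_module_module])
qed

lemma dec_op_decorate:
  assumes xs: "set xs \<subseteq> X" and u: "u \<in> carrier (free_module k (graded_ladder_free (length xs)))"
  shows "dec_op k X (decorate k X u xs) = decorate k X (graft k u) xs"
proof (rule linear_map_eqI[OF free_module_module linear_map_comp[OF dec_op_linear decorate_linear[OF xs]]
      linear_map_comp[OF decorate_linear[OF xs] graft_graded_linear] _ u])
  fix F assume "F \<in> graded_ladder_free (length xs)"
  then show "dec_op k X (decorate k X (basis_elem k F) xs) = decorate k X (graft k (basis_elem k F)) xs"
    using xs by (simp add: decorate_basis decorated_ladder_free_iff dec_op_basis graft_basis graft_graded)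
qed

theorem ShNC0_rota_baxter: "nonunitary_rota_baxter_algebra k lam (ShNC0 k lam X) (dec_op k X)"
  unfolding ShNC0_eq
proof (rule nonunitary_rota_baxter_algebra_on_basis[OF dec_prod_bilinear dec_op_linear lam_closed])
  fix s t r
  assume "s \<in> decorated X ladder_free_forests" "t \<in> decorated X ladder_free_forests"
    "r \<in> decorated X ladder_free_forests"
  moreover obtain F xs G ys H zs where "s = (F, xs)" "t = (G, ys)" "r = (H, zs)"
    by (metis prod.exhaust)
  ultimately have dec: "s = (F, xs)" "t = (G, ys)" "r = (H, zs)" "(F, xs) \<in> decorated X ladder_free_forests"
      "(G, ys) \<in> decorated X ladder_free_forests" "(H, zs) \<in> decorated X ladder_free_forests"
    by simp_all
  then have F: "F \<in> graded_ladder_free (length xs)" "set xs \<subseteq> X"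
    and G: "G \<in> graded_ladder_free (length ys)" "set ys \<subseteq> X"
    and H: "H \<in> graded_ladder_free (length zs)" "set zs \<subseteq> X"
    by (simp_all add: decorated_ladder_free_iff)
  have XS: "set (xs @ ys) \<subseteq> X" "set (ys @ zs) \<subseteq> X" using F G H by auto
  have forests: "F \<in> forests" "G \<in> forests" "H \<in> forests"
    using F G H graded_ladder_free_subset by blast+
  note b = basis_elem_closed[OF F(1)] basis_elem_closed[OF G(1)] basis_elem_closed[OF H(1)]
  note prods = bilinear_map_closed[OF diamond_graded b(1) b(2), folded length_append]
    bilinear_map_closed[OF diamond_graded b(2) b(3), folded length_append]
  show "dec_prod k lam X (dec_prod k lam X (basis_elem k s) (basis_elem k t)) (basis_elem k r)
    = dec_prod k lam X (basis_elem k s) (dec_prod k lam X (basis_elem k t) (basis_elem k r))"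
    unfolding dec(1-3) decorate_basis[OF dec(4), symmetric] decorate_basis[OF dec(5), symmetric]
      decorate_basis[OF dec(6), symmetric]
    unfolding dec_prod_decorate[OF F(2) G(2) b(1) b(2)] dec_prod_decorate[OF G(2) H(2) b(2) b(3)]
      dec_prod_decorate[OF XS(1) H(2) prods(1) b(3)] dec_prod_decorate[OF F(2) XS(2) b(1) prods(2)]
      diamond_assoc_basis[OF forests] append_assoc ..
next
  fix s t
  assume "s \<in> decorated X ladder_free_forests" "t \<in> decorated X ladder_free_forests"
  moreover obtain F xs G ys where "s = (F, xs)" "t = (G, ys)"
    by (metis prod.exhaust)
  ultimately have dec: "s = (F, xs)" "t = (G, ys)" "(F, xs) \<in> decorated X ladder_free_forests"
      "(G, ys) \<in> decorated X ladder_free_forests"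
    by simp_all
  then have F: "F \<in> graded_ladder_free (length xs)" "set xs \<subseteq> X"
    and G: "G \<in> graded_ladder_free (length ys)" "set ys \<subseteq> X"
    by (simp_all add: decorated_ladder_free_iff)
  have XS: "set (xs @ ys) \<subseteq> X" using F G by auto
  have forests: "basis_elem k F \<in> carrier (forest_module k)" "basis_elem k G \<in> carrier (forest_module k)"
    using F(1) G(1) graded_ladder_free_subset by (blast intro: basis_elem_closed)+
  note b = basis_elem_closed[OF F(1)] basis_elem_closed[OF G(1)]
  note g = linear_map_closed[OF graft_graded_linear b(1)] linear_map_closed[OF graft_graded_linear b(2)]
  note prods = bilinear_map_closed[OF diamond_graded g(1) b(2), folded length_append]
    bilinear_map_closed[OF diamond_graded b(1) g(2), folded length_append]
    bilinear_map_closed[OF diamond_graded b(1) b(2), folded length_append]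
  let ?D = "free_module k (decorated X ladder_free_forests)"
  let ?N = "diamond (graft k (basis_elem k F)) (basis_elem k G)
      \<oplus>\<^bsub>forest_module k\<^esub> diamond (basis_elem k F) (graft k (basis_elem k G))
      \<oplus>\<^bsub>forest_module k\<^esub> lam \<odot>\<^bsub>forest_module k\<^esub> diamond (basis_elem k F) (basis_elem k G)"
  have "decorate k X (graft k ?N) (xs @ ys) = dec_op k X (decorate k X ?N (xs @ ys))"
    by (rule dec_op_decorate[OF XS rota_baxter_sum_closed[OF prods], symmetric])
  also have "decorate k X ?N (xs @ ys)
      = decorate k X (diamond (graft k (basis_elem k F)) (basis_elem k G)) (xs @ ys)
      \<oplus>\<^bsub>?D\<^esub> decorate k X (diamond (basis_elem k F) (graft k (basis_elem k G))) (xs @ ys)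
      \<oplus>\<^bsub>?D\<^esub> lam \<odot>\<^bsub>?D\<^esub> decorate k X (diamond (basis_elem k F) (basis_elem k G)) (xs @ ys)"
    by (rule linear_map_rota_baxter_sum[OF decorate_linear[OF XS] prods])
  finally show "dec_prod k lam X (dec_op k X (basis_elem k s)) (dec_op k X (basis_elem k t)) =
      dec_op k X (dec_prod k lam X (dec_op k X (basis_elem k s)) (basis_elem k t)
        \<oplus>\<^bsub>?D\<^esub> dec_prod k lam X (basis_elem k s) (dec_op k X (basis_elem k t))
        \<oplus>\<^bsub>?D\<^esub> lam \<odot>\<^bsub>?D\<^esub> dec_prod k lam X (basis_elem k s) (basis_elem k t))"
    unfolding dec(1,2) decorate_basis[OF dec(3), symmetric] decorate_basis[OF dec(4), symmetric]
      dec_op_decorate[OF F(2) b(1)] dec_op_decorate[OF G(2) b(2)]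
      dec_prod_decorate[OF F(2) G(2) g(1) g(2)] dec_prod_decorate[OF F(2) G(2) g(1) b(2)]
      dec_prod_decorate[OF F(2) G(2) b(1) g(2)] dec_prod_decorate[OF F(2) G(2) b(1) b(2)]
      diamond_rota_baxter[OF forests] .
qed

end

section \<open>Evaluation of decorated forests in a Rota--Baxter algebra\<close>

text \<open>The value at the empty list is a dummy: there is no identity to serve as the empty product.\<close>

fun nonempty_prod :: "('k, 'r, 'n) module_scheme \<Rightarrow> 'r list \<Rightarrow> 'r" where
  "nonempty_prod A [] = \<zero>\<^bsub>A\<^esub>"
| "nonempty_prod A [x] = x"
| "nonempty_prod A (x # y # ys) = x \<otimes>\<^bsub>A\<^esub> nonempty_prod A (y # ys)"

text \<open>The word of letters of \<open>A\<close> spelled by a decorated forest. A tree with \<open>\<ell>\<close> leaves takes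
  the first \<open>\<ell> - 1\<close> decorations, which sit between its own leaves; the next decoration sits between this
  tree and the following one and becomes a letter of its own. For the last tree of a forest there is
  no next decoration, and \<open>take 1\<close> returns the empty list. If there is one decoration more,
  it becomes the last letter, so that a forest with \<open>leaves F\<close> decorations is a prefix ready to be
  continued (\<open>forest_factors_append\<close>).\<close>

fun tree_factors ::
    "('k, 'r, 'n) module_scheme \<Rightarrow> ('r \<Rightarrow> 'r) \<Rightarrow> ('x \<Rightarrow> 'r) \<Rightarrow> ptree \<Rightarrow> 'x list \<Rightarrow> 'r list"
  and forest_factors ::
    "('k, 'r, 'n) module_scheme \<Rightarrow> ('r \<Rightarrow> 'r) \<Rightarrow> ('x \<Rightarrow> 'r) \<Rightarrow> ptree list \<Rightarrow> 'x list \<Rightarrow> 'r list"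
where
  "tree_factors A P f (Node F) xs =
    (if F = [] then [] else [P (nonempty_prod A (forest_factors A P f F xs))])"
| "forest_factors A P f [] xs = []"
| "forest_factors A P f (T # F) xs =
    tree_factors A P f T (take (tree_leaves T - 1) xs)
    @ map f (take 1 (drop (tree_leaves T - 1) xs))
    @ forest_factors A P f F (drop (tree_leaves T) xs)"

lemma forest_factors_append:
  "length xs = leaves F \<Longrightarrow>
    forest_factors A P f (F @ G) (xs @ ys) = forest_factors A P f F xs @ forest_factors A P f G ys"
proof (induction F arbitrary: xs)
  case (Cons T F)
  have "tree_leaves T \<le> length xs" "tree_leaves T \<ge> 1"
    using Cons.prems tree_leaves_pos[of T] by simp_all
  moreover have "forest_factors A P f (F @ G) (drop (tree_leaves T) xs @ ys)
      = forest_factors A P f F (drop (tree_leaves T) xs) @ forest_factors A P f G ys"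
    by (rule Cons.IH) (use Cons.prems in simp)
  ultimately show ?case by simp
qed simp

lemma forest_factors_graft:
  assumes "F \<noteq> []" and "length xs = leaves F - 1"
  shows "forest_factors A P f [Node F] xs = [P (nonempty_prod A (forest_factors A P f F xs))]"
  using assms by (simp add: leaves_def)

text \<open>Two trees are separated by a decoration, and a single tree other than \<open>\<bullet>\<close> is a graft; each of them
  gives a letter.\<close>

lemma forest_factors_nonempty:
  assumes "F \<in> ladder_free_forests" and "length xs = leaves F - 1"
  shows "forest_factors A P f F xs \<noteq> []"
proof -
  obtain T G where F: "F = T # G"
    using assms(1) by (cases F) (auto simp: ladder_free_forests_def)
  show ?thesis
  proof (cases "G = []")
    case True
    then obtain H where "T = Node H" "H \<noteq> []"
      using assms(1) F by (cases T) (auto simp: ladder_free_forests_def)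
    then show ?thesis using F by simp
  next
    case False
    then have "\<not> length xs \<le> tree_leaves T - 1"
      using assms(2) F leaves_pos[of G] tree_leaves_pos[of T] by simp
    then show ?thesis using F by simp
  qed
qed

declare forest_factors.simps(2) [simp del]

locale rota_baxter_target = scalars k lam + A?: nonunitary_rota_baxter_algebra k lam A P
  for k (structure) and lam and A (structure) and P +
  fixes X :: "'x set" and f
  assumes f_closed: "f \<in> X \<rightarrow> carrier A"
begin

abbreviation nprod where "nprod \<equiv> nonempty_prod A"
abbreviation factors where "factors \<equiv> forest_factors A P f"

lemma A_module: "module k A" ..

lemma nprod_closed: "set xs \<subseteq> carrier A \<Longrightarrow> nprod xs \<in> carrier A"
proof (induction xs)
  case (Cons x xs)
  then show ?case by (cases xs) (auto intro: mult_closed)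
qed simp

lemma nprod_Cons: "xs \<noteq> [] \<Longrightarrow> nprod (x # xs) = x \<otimes>\<^bsub>A\<^esub> nprod xs"
  by (cases xs) simp_all

lemma nprod_append:
  "\<lbrakk>xs \<noteq> []; ys \<noteq> []; set xs \<subseteq> carrier A; set ys \<subseteq> carrier A\<rbrakk>
    \<Longrightarrow> nprod (xs @ ys) = nprod xs \<otimes>\<^bsub>A\<^esub> nprod ys"
proof (induction xs)
  case (Cons x xs)
  then show ?case
    by (cases xs; cases ys) (auto simp: mult_assoc nprod_closed)
qed simp

lemma nprod_context:
  assumes "set L \<subseteq> carrier A" and "set M \<subseteq> carrier A" and "set R \<subseteq> carrier A" and "M \<noteq> []"
  shows "nprod (L @ M @ R) = nprod (L @ [nprod M] @ R)"
  using assms nprod_closed[of M] by (cases "L = []"; cases "R = []") (simp_all add: nprod_append nprod_Cons)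

lemma nprod_context_linear:
  assumes L: "set L \<subseteq> carrier A" and R: "set R \<subseteq> carrier A"
  shows "(\<lambda>r. nprod (L @ [r] @ R)) \<in> linear_map k A A"
  by (rule linear_mapI; cases "L = []"; cases "R = []")
    (use L R nprod_closed in \<open>simp_all add: nprod_append nprod_Cons mult_l_distr mult_r_distr
      mult_smult_l mult_smult_r mult_closed\<close>)

lemma factors_closed_trees:
  assumes "\<And>T ys. \<lbrakk>T \<in> set F; set ys \<subseteq> X\<rbrakk> \<Longrightarrow> set (tree_factors A P f T ys) \<subseteq> carrier A"
    and "set xs \<subseteq> X"
  shows "set (factors F xs) \<subseteq> carrier A"
  using assms
proof (induction F arbitrary: xs)
  case (Cons T F)
  have "set (tree_factors A P f T (take (tree_leaves T - 1) xs)) \<subseteq> carrier A"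
    by (rule Cons.prems(1)) (use Cons.prems(2) set_take_subset in fastforce)+
  moreover have "set (factors F (drop (tree_leaves T) xs)) \<subseteq> carrier A"
    by (rule Cons.IH) (use Cons.prems set_drop_subset in fastforce)+
  moreover have "set (take 1 (drop (tree_leaves T - 1) xs)) \<subseteq> X"
    using Cons.prems(2) set_take_subset set_drop_subset by fast
  then have "f ` set (take 1 (drop (tree_leaves T - 1) xs)) \<subseteq> carrier A"
    using f_closed by blast
  ultimately show ?case by (simp add: forest_factors.simps(2))
qed simp

lemma tree_factors_closed: "set xs \<subseteq> X \<Longrightarrow> set (tree_factors A P f T xs) \<subseteq> carrier A"
proof (induction T arbitrary: xs)
  case (Node F)
  have "nprod (factors F xs) \<in> carrier A"
    by (rule nprod_closed[OF factors_closed_trees]) (use Node in auto)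
  then show ?case by (simp add: op_closed)
qed

lemma factors_closed: "set xs \<subseteq> X \<Longrightarrow> set (factors F xs) \<subseteq> carrier A"
  using factors_closed_trees tree_factors_closed by blast

lemma op_linear: "P \<in> linear_map k A A"
  by (rule linear_mapI) (auto simp: op_closed op_add op_smult)

lemma mult_bilinear: "(\<lambda>x y. x \<otimes>\<^bsub>A\<^esub> y) \<in> bilinear_map k A A A"
  by (rule bilinear_mapI; rule linear_mapI)
    (simp_all add: mult_closed mult_l_distr mult_r_distr mult_smult_l mult_smult_r)

text \<open>The words \<open>L\<close> and \<open>R\<close> stand for the parts of a larger forest around the one that is evaluated.\<close>

definition context_eval :: "_ \<Rightarrow> _ \<Rightarrow> 'x list \<Rightarrow> (ptree list \<Rightarrow> _) \<Rightarrow> _" where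
  "context_eval L R xs = lin_ext k A (\<lambda>F. nprod (L @ factors F xs @ R))"

context
  fixes L R and zs :: "'x list"
  assumes L: "set L \<subseteq> carrier A" and R: "set R \<subseteq> carrier A" and zs: "set zs \<subseteq> X"
begin

lemma context_value_closed: "nprod (L @ factors F zs @ R) \<in> carrier A"
  by (rule nprod_closed) (use L R factors_closed[OF zs] in auto)

lemma context_eval_linear: "context_eval L R zs \<in> linear_map k (free_module k S) A"
  unfolding context_eval_def
  by (rule lin_ext_linear[OF A_module]) (simp add: context_value_closed)

lemma context_eval_basis: "context_eval L R zs (basis_elem k F) = nprod (L @ factors F zs @ R)"
  unfolding context_eval_def by (simp add: lin_ext_basis[OF A_module] context_value_closed)

end

lemma context_eval_graft:
  assumes L: "set L \<subseteq> carrier A" and R: "set R \<subseteq> carrier A" and zs: "set zs \<subseteq> X"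
    and u: "u \<in> carrier (free_module k {F \<in> forests. leaves F = Suc (length zs)})"
  shows "context_eval L R zs (graft k u) = nprod (L @ [P (context_eval [] [] zs u)] @ R)"
proof (rule linear_map_eqI[OF A_module _ _ _ u])
  have "graft k \<in> linear_map k (free_module k {F \<in> forests. leaves F = Suc (length zs)}) (forest_module k)"
    by (rule graft_linear) auto
  then show "(\<lambda>u. context_eval L R zs (graft k u))
      \<in> linear_map k (free_module k {F \<in> forests. leaves F = Suc (length zs)}) A"
    by (rule linear_map_comp[OF context_eval_linear[OF L R zs]])
  show "(\<lambda>u. nprod (L @ [P (context_eval [] [] zs u)] @ R))
      \<in> linear_map k (free_module k {F \<in> forests. leaves F = Suc (length zs)}) A"
    by (rule linear_map_comp[OF linear_map_comp[OF nprod_context_linear[OF L R] op_linear]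
          context_eval_linear]) (use zs in auto)
  fix F assume "F \<in> {F \<in> forests. leaves F = Suc (length zs)}"
  then have "factors [Node F] zs = [P (nprod (factors F zs))]"
    by (intro forest_factors_graft) auto
  then show "context_eval L R zs (graft k (basis_elem k F))
      = nprod (L @ [P (context_eval [] [] zs (basis_elem k F))] @ R)"
    using context_eval_basis[of "[]" "[]" zs F] zs
    by (simp add: graft_basis context_eval_basis[OF L R zs])
qed

lemma factors_Cons:
  assumes "length us = tree_leaves U - 1"
  shows "factors (U # B) (us @ bs) = factors [U] us @ map f (take 1 bs) @ factors B (drop 1 bs)"
  using assms tree_leaves_pos[of U] by (simp add: forest_factors.simps(2))

text \<open>Evaluation is multiplicative before any products in \<open>A\<close> are formed: the words of the two factors are
  written side by side. This version also makes sense for the forest \<open>[\<bullet>]\<close> with its empty word, on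
  which the recursion of \<open>\<diamond>\<close> depends. The rest of the two forests around the junction is absorbed into
  \<open>L\<close> and \<open>R\<close>. For two grafts, the Rota--Baxter identity of \<open>A\<close> mirrors the recursive definition of the
  product of two trees; there the words inside \<open>P\<close> are nonempty because the trees are
  ladder-free, so that their concatenation evaluates to a product.\<close>

lemma context_eval_diamond:
  assumes "F \<noteq> []" and "G \<noteq> []"
    and "\<forall>T\<in>set F. ladder_free T" and "\<forall>T\<in>set G. ladder_free T"
    and "length xs = leaves F - 1" and "length ys = leaves G - 1"
    and "set xs \<subseteq> X" and "set ys \<subseteq> X" and "set L \<subseteq> carrier A" and "set R \<subseteq> carrier A"
  shows "context_eval L R (xs @ ys) (forest_prod k lam F G) = nprod (L @ factors F xs @ factors G ys @ R)"
  using assms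
proof (induction F G arbitrary: L R xs ys rule: diamond_induct)
  case (bullet_right T)
  then show ?case
    by (simp add: forest_prod_singletons tree_prod_bullet_right context_eval_basis forest_factors.simps(2))
next
  case (bullet_left T)
  then show ?case
    by (simp add: forest_prod_singletons tree_prod_bullet_left context_eval_basis forest_factors.simps(2))
next
  case (grafts F G)
  have XS: "set (xs @ ys) \<subseteq> X" using grafts.prems by simp
  have FG: "F \<in> ladder_free_forests" "G \<in> ladder_free_forests"
    using grafts ladder_free_Node by auto
  then have lf: "\<forall>T\<in>set F. ladder_free T" "\<forall>T\<in>set G. ladder_free T"
    by (auto simp: ladder_free_forests_def)
  have len: "length xs = leaves F - 1" "length ys = leaves G - 1"
    using grafts.prems grafts.hyps by (simp_all add: tree_leaves_Node del: tree_leaves.simps)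
  define p q where "p = nprod (factors F xs)" and "q = nprod (factors G ys)"
  have pq: "p \<in> carrier A" "q \<in> carrier A"
    unfolding p_def q_def using grafts.prems(5,6) by (simp_all only: nprod_closed factors_closed)
  have factors: "factors [Node F] xs = [P p]" "factors [Node G] ys = [P q]"
    unfolding p_def q_def
    by (rule forest_factors_graft[OF grafts.hyps(1) len(1)], rule forest_factors_graft[OF grafts.hyps(2) len(2)])
  have ne: "factors F xs \<noteq> []" "factors G ys \<noteq> []"
    by (rule forest_factors_nonempty[OF FG(1) len(1)], rule forest_factors_nonempty[OF FG(2) len(2)])
  have closed: "set (factors F xs) \<subseteq> carrier A" "set (factors G ys) \<subseteq> carrier A"
    using grafts.prems by (auto intro!: factors_closed)
  have a: "context_eval [] [] (xs @ ys) (forest_prod k lam [Node F] G) = P p \<otimes>\<^bsub>A\<^esub> q"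
    using grafts.IH(1)[of xs ys "[]" "[]"] grafts.prems lf len ne closed pq
    by (simp add: factors q_def nprod_Cons op_closed)
  have b: "context_eval [] [] (xs @ ys) (forest_prod k lam F [Node G]) = p \<otimes>\<^bsub>A\<^esub> P q"
    using grafts.IH(2)[of xs ys "[]" "[]"] grafts.prems lf len ne closed pq
    by (simp add: factors p_def nprod_append op_closed)
  have c: "context_eval [] [] (xs @ ys) (forest_prod k lam F G) = p \<otimes>\<^bsub>A\<^esub> q"
    using grafts.IH(3)[of xs ys "[]" "[]"] grafts.prems lf len ne closed
    by (simp add: p_def q_def nprod_append)
  have leaves: "leaves F + leaves G - 1 = Suc (length (xs @ ys))"
    using len leaves_pos[OF grafts.hyps(1)] leaves_pos[OF grafts.hyps(2)] by simp
  have targets: "forest_prod k lam F' G' \<in> carrier (free_module k {H \<in> forests. leaves H = Suc (length (xs @ ys))})"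
    if "F' \<noteq> []" "G' \<noteq> []" "leaves F' = leaves F" "leaves G' = leaves G" for F' G'
  proof -
    have "forest_targets F' G' \<subseteq> {H \<in> forests. leaves H = Suc (length (xs @ ys))}"
      unfolding forest_targets_def that(3,4) leaves by auto
    then show ?thesis
      by (rule subsetD[OF free_module_mono forest_prod_in_targets]) (use that(1,2) in auto)
  qed
  have leaves1: "leaves [Node F] = leaves F" "leaves [Node G] = leaves G"
    using grafts.hyps by (simp_all add: tree_leaves_Node del: tree_leaves.simps)
  have abc: "forest_prod k lam [Node F] G \<in> carrier (free_module k {H \<in> forests. leaves H = Suc (length (xs @ ys))})"
    "forest_prod k lam F [Node G] \<in> carrier (free_module k {H \<in> forests. leaves H = Suc (length (xs @ ys))})"
    "forest_prod k lam F G \<in> carrier (free_module k {H \<in> forests. leaves H = Suc (length (xs @ ys))})"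
    using targets[of "[Node F]" G] targets[of F "[Node G]"] targets[of F G] grafts.hyps leaves1 by auto
  have graft_closed: "graft k u \<in> carrier (forest_module k)"
    if "u \<in> carrier (free_module k {H \<in> forests. leaves H = Suc (length (xs @ ys))})" for u
    by (rule linear_map_closed[OF graft_linear that]) auto
  note ctx_graft = context_eval_graft[OF grafts.prems(7,8) XS]
  have mult: "P p \<otimes>\<^bsub>A\<^esub> q \<in> carrier A" "p \<otimes>\<^bsub>A\<^esub> P q \<in> carrier A" "p \<otimes>\<^bsub>A\<^esub> q \<in> carrier A"
    using pq by (simp_all add: mult_closed op_closed)
  note M = linear_map_comp[OF nprod_context_linear[OF grafts.prems(7,8)] op_linear]
  have "context_eval L R (xs @ ys) (forest_prod k lam [Node F] [Node G])
      = nprod (L @ [P (P p \<otimes>\<^bsub>A\<^esub> q)] @ R) \<oplus>\<^bsub>A\<^esub> nprod (L @ [P (p \<otimes>\<^bsub>A\<^esub> P q)] @ R)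
        \<oplus>\<^bsub>A\<^esub> lam \<odot>\<^bsub>A\<^esub> nprod (L @ [P (p \<otimes>\<^bsub>A\<^esub> q)] @ R)"
    unfolding forest_prod_singletons tree_prod_Node[OF grafts.hyps]
      linear_map_rota_baxter_sum[OF context_eval_linear[OF grafts.prems(7,8) XS]
        graft_closed[OF abc(1)] graft_closed[OF abc(2)] graft_closed[OF abc(3)]]
      ctx_graft[OF abc(1)] ctx_graft[OF abc(2)] ctx_graft[OF abc(3)] a b c ..
  also have "\<dots> = nprod (L @ [P (P p \<otimes>\<^bsub>A\<^esub> q \<oplus>\<^bsub>A\<^esub> p \<otimes>\<^bsub>A\<^esub> P q \<oplus>\<^bsub>A\<^esub> lam \<odot>\<^bsub>A\<^esub> (p \<otimes>\<^bsub>A\<^esub> q))] @ R)"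
    using mult lam_closed
    by (simp only: linear_map_add[OF M] linear_map_smult[OF M] A.smult_closed A.M.a_closed)
  also have "P (P p \<otimes>\<^bsub>A\<^esub> q \<oplus>\<^bsub>A\<^esub> p \<otimes>\<^bsub>A\<^esub> P q \<oplus>\<^bsub>A\<^esub> lam \<odot>\<^bsub>A\<^esub> (p \<otimes>\<^bsub>A\<^esub> q)) = nprod [P p, P q]"
    using rota_baxter[OF pq] by simp
  also have "nprod (L @ [nprod [P p, P q]] @ R) = nprod (L @ [P p, P q] @ R)"
    using grafts.prems(7,8) pq by (intro nprod_context[symmetric]) (auto simp: op_closed)
  finally show ?case by (simp add: factors)
next
  case (forests F G)
  obtain A' T where F: "F = A' @ [T]" using forests.hyps(1) by (cases F rule: rev_cases) auto
  obtain U B where G: "G = U # B" using forests.hyps(2) by (cases G) auto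
  define as ts us bs where "as = take (leaves A') xs" and "ts = drop (leaves A') xs"
    and "us = take (tree_leaves U - 1) ys" and "bs = drop (tree_leaves U - 1) ys"
  have split: "xs = as @ ts" "ys = us @ bs" by (simp_all add: as_def ts_def us_def bs_def)
  have len: "length as = leaves A'" "length ts = tree_leaves T - 1"
    "length us = tree_leaves U - 1" "length bs = leaves B"
    using forests.prems(3,4) F G tree_leaves_pos[of T] tree_leaves_pos[of U]
    by (simp_all add: as_def ts_def us_def bs_def)
  have X: "set as \<subseteq> X" "set ts \<subseteq> X" "set us \<subseteq> X" "set bs \<subseteq> X"
    using forests.prems(5,6) split by auto
  \<comment> \<open>The first decoration in \<open>bs\<close>, if there is one, separates \<open>U\<close> from \<open>B\<close>.\<close>
  define L' R' where "L' = L @ factors A' as" and "R' = map f (take 1 bs) @ factors B (drop 1 bs) @ R"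
  have "set (take 1 bs) \<subseteq> X" "set (drop 1 bs) \<subseteq> X"
    using X(4) set_take_subset set_drop_subset by fast+
  then have L'R': "set L' \<subseteq> carrier A" "set R' \<subseteq> carrier A"
    using forests.prems(7,8) X factors_closed f_closed unfolding L'_def R'_def by auto
  have XS: "set (xs @ ys) \<subseteq> X" "set (ts @ us) \<subseteq> X" using forests.prems(5,6) X by auto
  have "lin_ext k (forest_module k) (\<lambda>H. basis_elem k (A' @ H @ B))
      \<in> linear_map k (free_module k (tree_targets T U)) (forest_module k)"
    by (rule lin_ext_linear[OF FM_module]) (auto simp: tree_targets_def)
  then have pad: "(\<lambda>u. context_eval L R (xs @ ys)
        (lin_ext k (forest_module k) (\<lambda>H. basis_elem k (A' @ H @ B)) u))
      \<in> linear_map k (free_module k (tree_targets T U)) A"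
    by (rule linear_map_comp[OF context_eval_linear[OF forests.prems(7,8) XS(1)]])
  have "context_eval L R (xs @ ys) (forest_prod k lam F G) = context_eval L' R' (ts @ us) (tree_prod k lam T U)"
    unfolding forest_prod_nonempty[OF forests.hyps]
    unfolding F G butlast_snoc last_snoc list.sel
  proof (rule linear_map_eqI[OF A_module pad context_eval_linear[OF L'R' XS(2)] _ tree_prod_in_targets])
    fix H assume "H \<in> tree_targets T U"
    then obtain W where W: "H = [W]" "tree_leaves W = tree_leaves T + tree_leaves U - 1"
      by (auto simp: tree_targets_def)
    have "factors (A' @ W # B) (xs @ ys) = factors A' as @ factors (W # B) ((ts @ us) @ bs)"
      unfolding split using forest_factors_append[OF len(1)] by simp
    also have "\<dots> = factors A' as @ factors [W] (ts @ us) @ map f (take 1 bs) @ factors B (drop 1 bs)"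
      using W(2) len tree_leaves_pos[of T] tree_leaves_pos[of U] by (subst factors_Cons) simp_all
    finally show "context_eval L R (xs @ ys)
        (lin_ext k (forest_module k) (\<lambda>H. basis_elem k (A' @ H @ B)) (basis_elem k H))
      = context_eval L' R' (ts @ us) (basis_elem k H)"
      unfolding W(1) context_eval_basis[OF L'R' XS(2)]
      by (simp add: lin_ext_basis[OF FM_module] context_eval_basis[OF forests.prems(7,8) XS(1)]
          L'_def R'_def)
  qed
  also have "\<dots> = nprod (L' @ factors [T] ts @ factors [U] us @ R')"
    using forests.IH[of ts us L' R'] forests.prems(1,2) X L'R' len F G
    by (simp add: forest_prod_singletons)
  also have "\<dots> = nprod (L @ factors F xs @ factors G ys @ R)"
    unfolding F G split forest_factors_append[OF len(1)] factors_Cons[OF len(3)] L'_def R'_def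
    by (simp)
  finally show ?case .
qed

definition universal_hom where
  "universal_hom = lin_ext k A (\<lambda>(F, xs). nprod (factors F xs))"

lemma universal_hom_linear:
  "universal_hom \<in> linear_map k (free_module k (decorated X ladder_free_forests)) A"
  unfolding universal_hom_def
  by (rule lin_ext_linear[OF A_module])
    (auto simp: decorated_def intro!: nprod_closed factors_closed)

lemma universal_hom_basis:
  assumes "(F, xs) \<in> decorated X ladder_free_forests"
  shows "universal_hom (basis_elem k (F, xs)) = nprod (factors F xs)"
proof -
  have "nprod (factors F xs) \<in> carrier A"
    using assms by (auto simp: decorated_def intro!: nprod_closed factors_closed)
  then show ?thesis
    unfolding universal_hom_def by (simp add: lin_ext_basis[OF A_module])
qed

lemma universal_hom_decorate:
  assumes xs: "set xs \<subseteq> X" and u: "u \<in> carrier (free_module k (graded_ladder_free (length xs)))"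
  shows "universal_hom (decorate k X u xs) = context_eval [] [] xs u"
proof (rule linear_map_eqI[OF A_module linear_map_comp[OF universal_hom_linear decorate_linear[OF xs]]
      context_eval_linear _ u])
  fix F assume F: "F \<in> graded_ladder_free (length xs)"
  then have "(F, xs) \<in> decorated X ladder_free_forests"
    using xs by (simp add: decorated_ladder_free_iff)
  then show "universal_hom (decorate k X (basis_elem k F) xs) = context_eval [] [] xs (basis_elem k F)"
    using xs by (simp add: decorate_basis universal_hom_basis context_eval_basis)
qed (use xs in auto)

lemma universal_hom_mult:
  assumes u: "u \<in> carrier (free_module k (decorated X ladder_free_forests))"
    and v: "v \<in> carrier (free_module k (decorated X ladder_free_forests))"
  shows "universal_hom (dec_prod k lam X u v) = universal_hom u \<otimes>\<^bsub>A\<^esub> universal_hom v"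
proof (rule bilinear_map_eqI[OF A_module linear_bilinear_map_comp[OF universal_hom_linear dec_prod_bilinear]
      bilinear_map_comp[OF mult_bilinear universal_hom_linear universal_hom_linear] _ u v])
  fix s t
  assume st: "s \<in> decorated X ladder_free_forests" "t \<in> decorated X ladder_free_forests"
  obtain F xs G ys where eq: "s = (F, xs)" "t = (G, ys)" by (metis prod.exhaust)
  note dec = st[unfolded eq]
  have F: "F \<in> ladder_free_forests" "set xs \<subseteq> X" "length xs = leaves F - 1"
    and G: "G \<in> ladder_free_forests" "set ys \<subseteq> X" "length ys = leaves G - 1"
    using dec by (simp_all add: decorated_def)
  have grd: "F \<in> graded_ladder_free (length xs)" "G \<in> graded_ladder_free (length ys)"
    using dec by (simp_all add: decorated_ladder_free_iff)
  have ne: "F \<noteq> []" "G \<noteq> []" and lf: "\<forall>T\<in>set F. ladder_free T" "\<forall>T\<in>set G. ladder_free T"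
    using F(1) G(1) by (auto simp: ladder_free_forests_def)
  have "forest_prod k lam F G \<in> carrier (free_module k (graded_ladder_free (length (xs @ ys))))"
    using bilinear_map_closed[OF diamond_graded basis_elem_closed[OF grd(1)] basis_elem_closed[OF grd(2)]]
      ne by (simp add: diamond_basis)
  then have "universal_hom (dec_prod k lam X (basis_elem k s) (basis_elem k t))
      = context_eval [] [] (xs @ ys) (forest_prod k lam F G)"
    unfolding eq dec_prod_basis[OF dec] using F(2) G(2) by (intro universal_hom_decorate) auto
  also have "\<dots> = nprod (factors F xs @ factors G ys)"
    using context_eval_diamond[OF ne lf F(3) G(3) F(2) G(2), of "[]" "[]"] by simp
  also have "\<dots> = nprod (factors F xs) \<otimes>\<^bsub>A\<^esub> nprod (factors G ys)"
    by (rule nprod_append) (simp_all add: forest_factors_nonempty[OF F(1,3)] forest_factors_nonempty[OF G(1,3)]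
        factors_closed F(2) G(2))
  finally show "universal_hom (dec_prod k lam X (basis_elem k s) (basis_elem k t))
      = universal_hom (basis_elem k s) \<otimes>\<^bsub>A\<^esub> universal_hom (basis_elem k t)"
    unfolding eq universal_hom_basis[OF dec(1)] universal_hom_basis[OF dec(2)] .
qed

lemma universal_hom_op:
  assumes u: "u \<in> carrier (free_module k (decorated X ladder_free_forests))"
  shows "universal_hom (dec_op k X u) = P (universal_hom u)"
proof (rule linear_map_eqI[OF A_module linear_map_comp[OF universal_hom_linear dec_op_linear]
      linear_map_comp[OF op_linear universal_hom_linear] _ u])
  fix s assume s: "s \<in> decorated X ladder_free_forests"
  obtain F xs where eq: "s = (F, xs)" by (metis prod.exhaust)
  note dec = s[unfolded eq]
  then have "F \<noteq> []" "length xs = leaves F - 1" "([Node F], xs) \<in> decorated X ladder_free_forests"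
    by (auto simp: decorated_ladder_free_iff graft_graded)
      (auto simp: graded_ladder_free_def ladder_free_forests_def)
  then show "universal_hom (dec_op k X (basis_elem k s)) = P (universal_hom (basis_elem k s))"
    unfolding eq
    by (simp add: dec_op_basis[OF dec] universal_hom_basis dec forest_factors_graft
        del: leaves_simps)
qed

lemma universal_hom_gen:
  assumes "x \<in> X"
  shows "universal_hom (dec_gen k x) = f x"
proof -
  have "([bullet, bullet], [x]) \<in> decorated X ladder_free_forests"
    using assms by (simp add: decorated_def ladder_free_forests_def)
  then show ?thesis unfolding dec_gen_def by (simp add: universal_hom_basis forest_factors.simps(2))
qed

end

section \<open>Generators, uniqueness and freeness\<close>

context scalars
begin

lemma dec_gen_closed:
  assumes "x \<in> X"
  shows "dec_gen k x \<in> carrier (free_module k (decorated X ladder_free_forests))"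
  unfolding dec_gen_def
  by (rule basis_elem_closed) (use assms in \<open>simp add: decorated_def ladder_free_forests_def\<close>)

lemma forest_prod_bullet_end:
  assumes "G \<noteq> []"
  shows "forest_prod k lam (F @ [bullet]) G = basis_elem k (F @ G)"
  using assms by (simp add: forest_prod_nonempty tree_prod_bullet_left lin_ext_basis[OF FM_module])

lemma forest_prod_bullet_start:
  assumes "F \<noteq> []"
  shows "forest_prod k lam F (bullet # G) = basis_elem k (F @ G)"
proof -
  obtain A T where "F = A @ [T]" using assms by (cases F rule: rev_cases) auto
  then show ?thesis
    by (simp add: forest_prod_nonempty tree_prod_bullet_right lin_ext_basis[OF FM_module])
qed

text \<open>The induction follows the size of the forest. A single tree is a graft. A longer forest
  \<open>T \<squnion> G\<close> with decoration \<open>x\<close> after \<open>T\<close> is \<open>(T \<diamond> (\<bullet>\<squnion>\<bullet>; x)) \<diamond> G\<close>, where \<open>T \<diamond> (\<bullet>\<squnion>\<bullet>)\<close> is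
  \<open>T \<squnion> \<bullet>\<close> and its final \<open>\<bullet>\<close> is absorbed by \<open>G\<close>. A factor \<open>T\<close> or \<open>G\<close> that equals \<open>\<bullet>\<close> is not
  available in the ladder-free algebra, and is left out.\<close>

lemma ShNC0_generated:
  assumes gen: "\<And>x. x \<in> X \<Longrightarrow> dec_gen k x \<in> D"
    and mult: "\<And>s t. \<lbrakk>s \<in> decorated X ladder_free_forests; t \<in> decorated X ladder_free_forests;
      basis_elem k s \<in> D; basis_elem k t \<in> D\<rbrakk> \<Longrightarrow> dec_prod k lam X (basis_elem k s) (basis_elem k t) \<in> D"
    and op: "\<And>s. \<lbrakk>s \<in> decorated X ladder_free_forests; basis_elem k s \<in> D\<rbrakk>
      \<Longrightarrow> dec_op k X (basis_elem k s) \<in> D"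
    and "(F, xs) \<in> decorated X ladder_free_forests"
  shows "basis_elem k (F, xs) \<in> D"
  using assms(4)
proof (induction "size_list size F" arbitrary: F xs rule: less_induct)
  case less
  have F: "F \<in> ladder_free_forests" and X: "set xs \<subseteq> X" and len: "length xs = leaves F - 1"
    using less.prems by (simp_all add: decorated_def)
  have prod: "basis_elem k (H, ys @ zs) \<in> D"
    if "(G, ys) \<in> decorated X ladder_free_forests" "(G', zs) \<in> decorated X ladder_free_forests"
      "basis_elem k (G, ys) \<in> D" "basis_elem k (G', zs) \<in> D"
      "forest_prod k lam G G' = basis_elem k H"
      "(H, ys @ zs) \<in> decorated X ladder_free_forests" for G G' H ys zs
    using mult[OF that(1-4)] unfolding dec_prod_basis[OF that(1,2)] that(5) decorate_basis[OF that(6)] .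
  obtain T G where TG: "F = T # G"
    using F by (cases F) (auto simp: ladder_free_forests_def)
  show ?case
  proof (cases "G = []")
    case True
    then obtain H where H: "F = [Node H]" "H \<noteq> []"
      using F TG by (cases T) (auto simp: ladder_free_forests_def)
    then have dec: "(H, xs) \<in> decorated X ladder_free_forests"
      using F X len by (auto simp: decorated_def ladder_free_forests_def leaves_def)
    then have "basis_elem k (H, xs) \<in> D" by (rule less.hyps[rotated]) (simp add: H)
    from op[OF dec this] show ?thesis by (simp add: dec_op_basis[OF dec] H)
  next
    case False
    define ts gs where "ts = take (tree_leaves T - 1) xs" and "gs = drop (tree_leaves T) xs"
    have "tree_leaves T - 1 < length xs"
      using len TG leaves_pos[OF False] tree_leaves_pos[of T] by simp
    moreover define x where "x = xs ! (tree_leaves T - 1)"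
    ultimately have xs: "xs = ts @ [x] @ gs"
      using tree_leaves_pos[of T] id_take_nth_drop[of "tree_leaves T - 1" xs]
      by (simp add: ts_def gs_def)
    have lens: "length ts = tree_leaves T - 1" "length gs = leaves G - 1"
      using len TG tree_leaves_pos[of T] by (auto simp: ts_def gs_def)
    have X': "set ts \<subseteq> X" "x \<in> X" "set gs \<subseteq> X" using X xs by auto
    have lf: "ladder_free T" "\<forall>T\<in>set G. ladder_free T"
      using F TG by (auto simp: ladder_free_forests_def)
    have dec_Tx: "([T, bullet], ts @ [x]) \<in> decorated X ladder_free_forests"
      using X' lens lf tree_leaves_pos[of T] by (auto simp: decorated_def ladder_free_forests_def)
    have dec_gen: "([bullet, bullet], [x]) \<in> decorated X ladder_free_forests"
      using X' by (simp add: decorated_def ladder_free_forests_def)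
    have gen': "basis_elem k ([bullet, bullet], [x]) \<in> D"
      using gen[OF X'(2)] by (simp add: dec_gen_def)
    have Tx: "basis_elem k ([T, bullet], ts @ [x]) \<in> D"
    proof (cases "T = bullet")
      case True
      then show ?thesis using gen' lens by simp
    next
      case T: False
      have dec_T: "([T], ts) \<in> decorated X ladder_free_forests"
        using X' lens lf T by (simp add: decorated_def ladder_free_forests_def)
      have "basis_elem k ([T], ts) \<in> D"
        by (rule less.hyps[OF _ dec_T]) (use TG False in \<open>cases G; simp\<close>)
      then show ?thesis
        by (rule prod[OF dec_T dec_gen _ gen' _ dec_Tx]) (simp add: forest_prod_bullet_start)
    qed
    show ?thesis
    proof (cases "G = [bullet]")
      case True
      then show ?thesis using Tx xs lens TG by simp
    next
      case G: False
      have dec_G: "(G, gs) \<in> decorated X ladder_free_forests"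
        using X' lens lf False G by (simp add: decorated_def ladder_free_forests_def)
      have "basis_elem k (G, gs) \<in> D"
        by (rule less.hyps[OF _ dec_G]) (simp add: TG)
      moreover have "forest_prod k lam [T, bullet] G = basis_elem k F"
        using forest_prod_bullet_end[OF False, of "[T]"] TG by simp
      ultimately have "basis_elem k (F, (ts @ [x]) @ gs) \<in> D"
        using less.prems xs by (intro prod[OF dec_Tx dec_G Tx]) simp_all
      then show ?thesis using xs by simp
    qed
  qed
qed

lemma rota_baxter_hom_unique:
  assumes A: "nonunitary_rota_baxter_algebra k lam A P"
    and g: "g \<in> rota_baxter_hom k (ShNC0 k lam X) (dec_op k X) A P"
    and h: "h \<in> rota_baxter_hom k (ShNC0 k lam X) (dec_op k X) A P"
    and gen: "\<And>x. x \<in> X \<Longrightarrow> g (dec_gen k x) = h (dec_gen k x)"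
    and u: "u \<in> carrier (ShNC0 k lam X)"
  shows "g u = h u"
proof -
  let ?D = "free_module k (decorated X ladder_free_forests)"
  interpret A: nonunitary_rota_baxter_algebra k lam A P by fact
  have lin: "g \<in> linear_map k ?D A" "h \<in> linear_map k ?D A"
    using g h by (simp_all add: linear_map_def rota_baxter_hom_def ShNC0_eq)
  have g_mult: "g (dec_prod k lam X u v) = g u \<otimes>\<^bsub>A\<^esub> g v" and h_mult: "h (dec_prod k lam X u v) = h u \<otimes>\<^bsub>A\<^esub> h v"
    if "u \<in> carrier ?D" "v \<in> carrier ?D" for u v
    using g h that by (simp_all add: rota_baxter_hom_def ShNC0_eq)
  have op: "g (dec_op k X u) = P (g u)" "h (dec_op k X u) = P (h u)" if "u \<in> carrier ?D" for u
    using g h that by (simp_all add: rota_baxter_hom_def ShNC0_eq)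
  have "basis_elem k s \<in> {v. g v = h v}" if "s \<in> decorated X ladder_free_forests" for s
    using that
    by (cases s, hypsubst, intro ShNC0_generated[where X = X]) (simp_all add: gen g_mult h_mult op)
  then have basis: "g (basis_elem k s) = h (basis_elem k s)" if "s \<in> decorated X ladder_free_forests" for s
    using that by simp
  show ?thesis
    by (rule linear_map_eqI[OF A.module_axioms lin basis]) (use u in \<open>simp_all add: ShNC0_eq\<close>)
qed

end

theorem theorem3p9:
  fixes k :: "('k, 'm) ring_scheme" and lam :: 'k and X :: "'x set"
  assumes "cring k" and "lam \<in> carrier k"
  shows "nonunitary_rota_baxter_algebra k lam (ShNC0 k lam X) (dec_op k X)
    \<and> dec_gen k ` X \<subseteq> carrier (ShNC0 k lam X)
    \<and> (\<forall>(R :: ('k, 'r, 'n) module_scheme) P f.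
          nonunitary_rota_baxter_algebra k lam R P \<and> f \<in> X \<rightarrow> carrier R \<longrightarrow>
          (\<exists>!h. h \<in> extensional (carrier (ShNC0 k lam X))
              \<and> h \<in> rota_baxter_hom k (ShNC0 k lam X) (dec_op k X) R P
              \<and> (\<forall>x\<in>X. h (dec_gen k x) = f x)))"
proof -
  interpret scalars k lam
    using assms by (simp add: scalars_def scalars_axioms_def)
  let ?S = "ShNC0 k lam X"
  let ?D = "free_module k (decorated X ladder_free_forests)"
  have gen: "dec_gen k x \<in> carrier ?S" if "x \<in> X" for x
    using dec_gen_closed[OF that] by (simp add: ShNC0_eq)
  have universal: "\<exists>!h. h \<in> extensional (carrier ?S) \<and> h \<in> rota_baxter_hom k ?S (dec_op k X) R P
      \<and> (\<forall>x\<in>X. h (dec_gen k x) = f x)"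
    if R: "nonunitary_rota_baxter_algebra k lam R P" and f: "f \<in> X \<rightarrow> carrier R"
    for R :: "('k, 'r, 'n) module_scheme" and P f
  proof -
    interpret target: rota_baxter_target k lam R P X f
      using R f scalars_axioms by (simp add: rota_baxter_target_def rota_baxter_target_axioms_def)
    let ?h = "restrict target.universal_hom (carrier ?S)"
    interpret S: nonunitary_rota_baxter_algebra k lam ?S "dec_op k X" by (rule ShNC0_rota_baxter)
    have hom: "?h \<in> rota_baxter_hom k ?S (dec_op k X) R P"
      using target.universal_hom_linear target.universal_hom_mult target.universal_hom_op
        S.mult_closed S.op_closed S.M.a_closed S.smult_closed
      by (simp add: rota_baxter_hom_def linear_map_def ShNC0_eq Pi_iff)
    have "?h (dec_gen k x) = f x" if "x \<in> X" for x
      using gen[OF that] target.universal_hom_gen[OF that] by simp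
    with hom show ?thesis
    proof (intro ex1I[of _ ?h] conjI ballI)
      fix g
      assume g: "g \<in> extensional (carrier ?S) \<and> g \<in> rota_baxter_hom k ?S (dec_op k X) R P
        \<and> (\<forall>x\<in>X. g (dec_gen k x) = f x)"
      show "g = ?h"
        by (rule extensionalityI[of _ "carrier ?S"], use g in blast, simp)
          (rule rota_baxter_hom_unique[OF R _ hom], use g \<open>\<And>x. x \<in> X \<Longrightarrow> ?h (dec_gen k x) = f x\<close> in auto)
    qed auto
  qed
  show ?thesis
  proof (intro conjI allI impI)
    show "nonunitary_rota_baxter_algebra k lam ?S (dec_op k X)" by (rule ShNC0_rota_baxter)
    show "dec_gen k ` X \<subseteq> carrier ?S" using gen by blast
  qed (elim conjE, rule universal)
qed

end
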